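(* Let $W$ be a well-generated irreducible complex reflection group with reflection arrangement $\mathscr{A}$ and order multiplicity $\omega$. Let $\nu:\mathscr{A}\to\mathbb{Z}$ be a multiplicity function and let $\zeta\in\mathfrak{D}(\mathscr{A},-\infty)^W$ be $\nu$-universal. Let $\mu:\mathscr{A}\to\mathbb{Z}$ be a multiplicity function with $-\omega+1\le\mu\le1$ (pointwise). Then $$\Phi_\zeta:\mathfrak{D}(\mathscr{A},\mu)\to\mathfrak{D}(\mathscr{A},\nu+\mu),\qquad\theta\mapsto\nabla_\theta(\zeta),$$ is an isomorphism of $S$-modules. In particular, $\mathfrak{D}(\mathscr{A},\mu)$ is free (as an $S$-module) if and only if $\mathfrak{D}(\mathscr{A},\nu+\mu)$ is free.
   Context: $V\cong\mathbb{C}^\ell$, and $W\subset \mathrm{GL}(V)$ is a finite irreducible group generated by (complex) reflections; well-generated means generated by $\ell$ reflections. $I$ is a $W$-invariant Hermitian inner product on $V$, $I^*$ the induced one on $V^*$. $\mathscr{A}$ is the set of reflecting hyperplanes; $e_H$ is the order of the pointwise stabilizer of $H$ in $W$, $\omega(H):=e_H$, and $\alpha_H\in V^*$ is fixed with $H=\ker\alpha_H$, $I^*(\alpha_H,\alpha_H)=1$. $S=\mathrm{Sym}(V^* )=\mathbb{C}[x_1,\dots,x_\ell]$ for a basis $x_1,\dots,x_\ell$ of $V^*$; $F=\mathrm{Frac}(S)$; $\mathrm{Der}_S=\bigoplus_i S\,\partial_{x_i}\subset\mathrm{Der}_F=\bigoplus_i F\,\partial_{x_i}$. $W$ acts on $\mathrm{Der}_F$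 by $(w\theta)(f)=w(\theta(w^{-1}f))$, and $(\cdot)^W$ denotes $W$-invariants. A derivation $\theta=\sum_i (f_i/g_i)\partial_{x_i}$ with all $f_i$ homogeneous of degree $p$ (or $0$) and all $g_i\ne0$ homogeneous of degree $q$ is called homogeneous with $\mathrm{pdeg}\,\theta=p-q$. $Q_{\mathscr{A}}=\prod_{H}\alpha_H$, $S'=S[Q_{\mathscr{A}}^{-1}]$, $\mathrm{Der}_{S'}=\bigoplus_i S'\partial_{x_i}$, $S_{\langle\alpha_H\rangle}$ is the localization of $S$ at the prime ideal $\langle\alpha_H\rangle$; $\mathfrak{D}(\mathscr{A},-\infty)=\{\theta\in\mathrm{Der}_{S'}\mid \theta(\beta)\in S_{\langle\alpha_H\rangle}\text{ for all }H\in\mathscr{A},\ \beta\in V^*\text{ with }I^*(\alpha_H,\beta)=0\}$, and for $\nu:\mathscr{A}\to\mathbb{Z}$, $\mathfrak{D}(\mathscr{A},\nu)=\{\theta\in\mathfrak{D}(\mathscr{A},-\infty)\mid\theta(\alpha_H)\in\alpha_H^{\nu(H)}S_{\langle\alpha_H\rangle}\text{ for all }H\in\mathscr{A}\}$. Integers are also used for constant multiplicity functions. Connection: $\nabla_\theta(\sum_i p_i\partial_{x_i})=\sum_i\theta(p_i)\partial_{x_i}$ for $\theta\in\mathrm{Der}_F$, $p_i\in F$. Universality: a homogeneous $\zeta\in\mathfrak{D}(\mathscr{A},-\infty)$ is $\nu$-universal if $\Phi_\zeta:\mathrm{Der}_S\to\mathfrak{D}(\mathscr{A},\nu)$, $\theta\mapsto\nabla_\theta(\zeta)$,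 is a (well-defined) isomorphism of $S$-modules. The formula $\theta\mapsto\nabla_\theta(\zeta)$ makes sense for all $\theta\in\mathrm{Der}_F$, and $\Phi_\zeta$ denotes its restriction to whichever submodule is indicated. *)

theory Defs
  imports
    "HOL-Analysis.Analysis"
    "HOL-Algebra.Generated_Groups"
    "HOL-Library.Poly_Mapping"
    "HOL-Computational_Algebra.Fraction_Field"
begin

text \<open>
  The space \<open>V\<close> is \<open>complex ^ 'n\<close>, so \<open>\<ell> = CARD('n)\<close>. The order on the index type is used
  only because the library proves that monoid algebras are integral domains for linearly ordered
  monoids; it plays no mathematical role, and index types in the class exist for every finite
  positive cardinality. Linear forms are represented by their coefficient vectors with respect to
  the coordinate functions.
\<close>

section \<open>The polynomial ring and its fraction field\<close>

type_synonym 'n cvec = "(complex, 'n) vec"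
type_synonym 'n cmat = "((complex, 'n) vec, 'n) vec"
type_synonym 'n mpoly = "('n \<Rightarrow>\<^sub>0 nat) \<Rightarrow>\<^sub>0 complex"
type_synonym 'n mfrac = "('n mpoly) fract"

lemma poly_mapping_add_induct [case_names zero single add]:
  fixes p :: "'a \<Rightarrow>\<^sub>0 'b::comm_monoid_add"
  assumes zero: "P 0"
    and single: "\<And>m c. P (Poly_Mapping.single m c)"
    and add: "\<And>p q. P p \<Longrightarrow> P q \<Longrightarrow> P (p + q)"
  shows "P p"
proof (induction p rule: Poly_Mapping.update_induct)
  case const
  show ?case by (rule zero)
next
  case (update f a b)
  have "Poly_Mapping.update a b f = f + Poly_Mapping.single a b"
    using update(1)
    by (intro poly_mapping_eqI)
      (auto simp: lookup_update lookup_add lookup_single when_def in_keys_iff)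
  then show ?case
    using update single add by metis
qed

definition mpoly_var :: "'n \<Rightarrow> 'n mpoly" where
  "mpoly_var i = Poly_Mapping.single (Poly_Mapping.single i 1) 1"

definition mpoly_const :: "complex \<Rightarrow> 'n mpoly" where
  "mpoly_const c = Poly_Mapping.single 0 c"

definition linear_poly :: "'n cvec \<Rightarrow> ('n::{finite,linorder}) mpoly" where
  "linear_poly a = (\<Sum>i\<in>UNIV. mpoly_const (a $ i) * mpoly_var i)"

definition homogeneous_mpoly :: "nat \<Rightarrow> ('n::finite) mpoly \<Rightarrow> bool" where
  "homogeneous_mpoly d p \<longleftrightarrow>
     (\<forall>m\<in>Poly_Mapping.keys p. (\<Sum>i\<in>UNIV. Poly_Mapping.lookup m i) = d)"

definition to_mfrac :: "('n::{finite,linorder}) mpoly \<Rightarrow> 'n mfrac" where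
  "to_mfrac p = Fract p 1"

lemma to_mfrac_add: "to_mfrac (p + q) = to_mfrac p + to_mfrac q"
  by (simp add: to_mfrac_def)

lemma to_mfrac_mult: "to_mfrac (p * q) = to_mfrac p * to_mfrac q"
  by (simp add: to_mfrac_def)

lemma to_mfrac_one [simp]: "to_mfrac 1 = 1"
  by (simp add: to_mfrac_def One_fract_def)

subsection \<open>Partial derivatives\<close>

definition mpoly_pderiv :: "'n \<Rightarrow> 'n mpoly \<Rightarrow> 'n mpoly" where
  "mpoly_pderiv i p = (\<Sum>m\<in>Poly_Mapping.keys p.
     Poly_Mapping.single (m - Poly_Mapping.single i 1)
       (of_nat (Poly_Mapping.lookup m i) * Poly_Mapping.lookup p m))"

lemma sum_keys_superset:
  assumes "finite A" "Poly_Mapping.keys p \<subseteq> A" "\<And>m. g m 0 = 0"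
  shows "(\<Sum>m\<in>Poly_Mapping.keys p. g m (Poly_Mapping.lookup p m)) =
         (\<Sum>m\<in>A. g m (Poly_Mapping.lookup p m))"
  using assms by (intro sum.mono_neutral_left) (auto simp: in_keys_iff)

lemma sum_keys_add:
  fixes p q :: "'a \<Rightarrow>\<^sub>0 'b::comm_monoid_add"
  assumes "\<And>m. g m 0 = 0" and "\<And>m a b. g m (a + b) = g m a + g m b"
  shows "(\<Sum>m\<in>Poly_Mapping.keys (p + q). g m (Poly_Mapping.lookup (p + q) m)) =
    (\<Sum>m\<in>Poly_Mapping.keys p. g m (Poly_Mapping.lookup p m)) +
    (\<Sum>m\<in>Poly_Mapping.keys q. g m (Poly_Mapping.lookup q m))"
proof -
  let ?A = "Poly_Mapping.keys p \<union> Poly_Mapping.keys q"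
  have "(\<Sum>m\<in>Poly_Mapping.keys (p + q). g m (Poly_Mapping.lookup (p + q) m)) =
      (\<Sum>m\<in>?A. g m (Poly_Mapping.lookup (p + q) m))"
    using Poly_Mapping.keys_add[of p q] assms(1) by (intro sum_keys_superset) auto
  moreover have "(\<Sum>m\<in>Poly_Mapping.keys p. g m (Poly_Mapping.lookup p m)) =
      (\<Sum>m\<in>?A. g m (Poly_Mapping.lookup p m))"
    using assms(1) by (intro sum_keys_superset) auto
  moreover have "(\<Sum>m\<in>Poly_Mapping.keys q. g m (Poly_Mapping.lookup q m)) =
      (\<Sum>m\<in>?A. g m (Poly_Mapping.lookup q m))"
    using assms(1) by (intro sum_keys_superset) auto
  ultimately show ?thesis
    by (simp add: lookup_add assms(2) sum.distrib)
qed

lemma mpoly_pderiv_zero [simp]: "mpoly_pderiv i 0 = 0"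
  by (simp add: mpoly_pderiv_def)

lemma mpoly_pderiv_add: "mpoly_pderiv i (p + q) = mpoly_pderiv i p + mpoly_pderiv i q"
  unfolding mpoly_pderiv_def
  by (rule sum_keys_add[where g = "\<lambda>m c. Poly_Mapping.single (m - Poly_Mapping.single i 1)
       (of_nat (Poly_Mapping.lookup m i) * c)"])
    (simp_all add: algebra_simps single_add)

lemma mpoly_pderiv_single:
  "mpoly_pderiv i (Poly_Mapping.single m c) =
     Poly_Mapping.single (m - Poly_Mapping.single i 1) (of_nat (Poly_Mapping.lookup m i) * c)"
  by (simp add: mpoly_pderiv_def)

lemma monomial_shift:
  fixes m n :: "'n \<Rightarrow>\<^sub>0 nat"
  assumes "Poly_Mapping.lookup m i > 0"
  shows "m + n - Poly_Mapping.single i 1 = (m - Poly_Mapping.single i 1) + n"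
  using assms
  by (intro poly_mapping_eqI) (auto simp: lookup_add lookup_minus lookup_single when_def)

lemma mpoly_pderiv_mult_single:
  "mpoly_pderiv i (Poly_Mapping.single m a * Poly_Mapping.single n b) =
     mpoly_pderiv i (Poly_Mapping.single m a) * Poly_Mapping.single n b +
     Poly_Mapping.single m a * mpoly_pderiv i (Poly_Mapping.single n b)"
proof -
  have m: "Poly_Mapping.single (m + n - Poly_Mapping.single i 1)
        (of_nat (Poly_Mapping.lookup m i) * (a * b)) =
      Poly_Mapping.single (m - Poly_Mapping.single i 1 + n)
        (of_nat (Poly_Mapping.lookup m i) * (a * b))"
    by (cases "Poly_Mapping.lookup m i = 0") (simp_all add: monomial_shift[unfolded One_nat_def])
  have n: "Poly_Mapping.single (m + n - Poly_Mapping.single i 1)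
        (of_nat (Poly_Mapping.lookup n i) * (a * b)) =
      Poly_Mapping.single (m + (n - Poly_Mapping.single i 1))
        (of_nat (Poly_Mapping.lookup n i) * (a * b))"
    using monomial_shift[of n i m]
    by (cases "Poly_Mapping.lookup n i = 0") (simp_all add: add.commute)
  show ?thesis
    using m n
    by (simp add: mult_single mpoly_pderiv_single lookup_add algebra_simps single_add)
qed

lemma mpoly_pderiv_mult:
  "mpoly_pderiv i (p * q) = mpoly_pderiv i p * q + p * mpoly_pderiv i q"
proof (induction p rule: poly_mapping_add_induct)
  case (single m c)
  show ?case
    by (induction q rule: poly_mapping_add_induct)
      (simp_all add: mpoly_pderiv_mult_single mpoly_pderiv_add algebra_simps)
qed (simp_all add: mpoly_pderiv_add algebra_simps)

lemma quotient_rule_identity: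
  fixes a b c d a' b' c' d' :: "'a::idom"
  assumes "a * d = c * b" and "a' * d + a * d' = c' * b + c * b'"
  shows "(a' * b - a * b') * (d * d) = (c' * d - c * d') * (b * b)"
proof -
  have "(a' * b - a * b') * (d * d) =
      b * d * (a' * d + a * d') - b * d' * (a * d) - b' * d * (a * d)"
    by (simp only: algebra_simps)
  also have "\<dots> = b * d * (c' * b + c * b') - b * d' * (c * b) - b' * d * (c * b)"
    by (simp only: assms)
  also have "\<dots> = (c' * d - c * d') * (b * b)"
    by (simp only: algebra_simps)
  finally show ?thesis .
qed

lift_definition mfrac_pderiv :: "'n::{finite,linorder} \<Rightarrow> 'n mfrac \<Rightarrow> 'n mfrac"
  is "\<lambda>i (a, b). (mpoly_pderiv i a * b - a * mpoly_pderiv i b, b * b)"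
proof (clarsimp)
  fix i :: 'n and a b c d :: "'n mpoly"
  assume nz: "b \<noteq> 0" "d \<noteq> 0" and eq: "a * d = c * b"
  let ?D = "mpoly_pderiv i"
  have D: "?D a * d + a * ?D d = ?D c * b + c * ?D b"
    using arg_cong[OF eq, of ?D] by (simp add: mpoly_pderiv_mult)
  show "(?D a * b - a * ?D b) * (d * d) = (?D c * d - c * ?D d) * (b * b)"
    using eq D by (rule quotient_rule_identity)
qed

lemma mfrac_pderiv_Fract:
  assumes "b \<noteq> 0"
  shows "mfrac_pderiv i (Fract a b) =
    Fract (mpoly_pderiv i a * b - a * mpoly_pderiv i b) (b * b)"
  using assms by (transfer fixing: i a b) simp

subsection \<open>Substitution and the action of matrices\<close>

definition mpoly_subst :: "('n \<Rightarrow> 'm mpoly) \<Rightarrow> 'n mpoly \<Rightarrow> ('m::{finite,linorder}) mpoly" where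
  "mpoly_subst f p = (\<Sum>m\<in>Poly_Mapping.keys p.
     mpoly_const (Poly_Mapping.lookup p m) * (\<Prod>i\<in>Poly_Mapping.keys m. f i ^ Poly_Mapping.lookup m i))"

lemma mpoly_const_zero [simp]: "mpoly_const 0 = 0"
  by (simp add: mpoly_const_def)

lemma mpoly_const_one [simp]: "mpoly_const 1 = 1"
  by (simp add: mpoly_const_def)

lemma mpoly_const_add: "mpoly_const (a + b) = mpoly_const a + mpoly_const b"
  by (simp add: mpoly_const_def single_add)

lemma mpoly_const_mult: "mpoly_const (a * b) = mpoly_const a * mpoly_const b"
  by (simp add: mpoly_const_def mult_single)

lemma mpoly_subst_zero [simp]: "mpoly_subst f 0 = 0"
  by (simp add: mpoly_subst_def)

lemma mpoly_subst_add: "mpoly_subst f (p + q) = mpoly_subst f p + mpoly_subst f q"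
  unfolding mpoly_subst_def
  by (rule sum_keys_add[where g = "\<lambda>m c. mpoly_const c *
       (\<Prod>i\<in>Poly_Mapping.keys m. f i ^ Poly_Mapping.lookup m i)"])
    (simp_all add: mpoly_const_add algebra_simps)

lemma mpoly_subst_single:
  fixes f :: "'n::finite \<Rightarrow> ('m::{finite,linorder}) mpoly"
  shows "mpoly_subst f (Poly_Mapping.single m c) =
     mpoly_const c * (\<Prod>i\<in>UNIV. f i ^ Poly_Mapping.lookup m i)"
proof -
  have "(\<Prod>i\<in>Poly_Mapping.keys m. f i ^ Poly_Mapping.lookup m i) =
      (\<Prod>i\<in>UNIV. f i ^ Poly_Mapping.lookup m i)"
    by (rule prod.mono_neutral_left) (auto simp: in_keys_iff)
  then show ?thesis
    by (simp add: mpoly_subst_def)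
qed

lemma mpoly_subst_mult:
  fixes f :: "'n::finite \<Rightarrow> ('m::{finite,linorder}) mpoly"
  shows "mpoly_subst f (p * q) = mpoly_subst f p * mpoly_subst f q"
proof (induction p rule: poly_mapping_add_induct)
  case (single m c)
  show ?case
    by (induction q rule: poly_mapping_add_induct)
      (simp_all add: mult_single mpoly_subst_single mpoly_const_mult lookup_add power_add
        prod.distrib mpoly_subst_add algebra_simps)
qed (simp_all add: mpoly_subst_add algebra_simps)

lemma mpoly_subst_const [simp]:
  fixes f :: "'n::finite \<Rightarrow> ('m::{finite,linorder}) mpoly"
  shows "mpoly_subst f (mpoly_const c) = mpoly_const c"
  unfolding mpoly_const_def[of c, where ?'n = 'n] by (simp add: mpoly_subst_single)

lemma mpoly_subst_var [simp]:
  fixes f :: "'n::finite \<Rightarrow> ('m::{finite,linorder}) mpoly"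
  shows "mpoly_subst f (mpoly_var i) = f i"
proof -
  have "(\<Prod>j\<in>UNIV. f j ^ Poly_Mapping.lookup (Poly_Mapping.single i (1::nat)) j) =
      (\<Prod>j\<in>UNIV. if j = i then f j else 1)"
    by (rule prod.cong) (auto simp: lookup_single when_def)
  then show ?thesis
    by (simp add: mpoly_var_def mpoly_subst_single)
qed

lemma mpoly_subst_one [simp]:
  fixes f :: "'n::finite \<Rightarrow> ('m::{finite,linorder}) mpoly"
  shows "mpoly_subst f 1 = 1"
  using mpoly_subst_const[of f 1] by (simp del: mpoly_subst_const)

lemma mpoly_subst_power:
  fixes f :: "'n::finite \<Rightarrow> ('m::{finite,linorder}) mpoly"
  shows "mpoly_subst f (p ^ k) = mpoly_subst f p ^ k"
  by (induction k) (simp_all add: mpoly_subst_mult)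

lemma mpoly_subst_prod:
  fixes f :: "'n::finite \<Rightarrow> ('m::{finite,linorder}) mpoly"
  shows "finite A \<Longrightarrow> mpoly_subst f (\<Prod>i\<in>A. g i) = (\<Prod>i\<in>A. mpoly_subst f (g i))"
  by (induction A rule: finite_induct) (simp_all add: mpoly_subst_mult)

lemma mpoly_subst_sum:
  fixes f :: "'n::finite \<Rightarrow> ('m::{finite,linorder}) mpoly"
  shows "finite A \<Longrightarrow> mpoly_subst f (\<Sum>i\<in>A. g i) = (\<Sum>i\<in>A. mpoly_subst f (g i))"
  by (induction A rule: finite_induct) (simp_all add: mpoly_subst_add)

lemma mpoly_subst_subst:
  fixes f :: "'n::finite \<Rightarrow> ('m::{finite,linorder}) mpoly"
    and g :: "'m \<Rightarrow> ('k::{finite,linorder}) mpoly"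
  shows "mpoly_subst g (mpoly_subst f p) = mpoly_subst (\<lambda>i. mpoly_subst g (f i)) p"
  by (induction p rule: poly_mapping_add_induct)
    (simp_all add: mpoly_subst_add mpoly_subst_single mpoly_subst_mult mpoly_subst_prod
      mpoly_subst_power)

lemma mpoly_var_power:
  "mpoly_var i ^ k = Poly_Mapping.single (Poly_Mapping.single i k) 1"
  by (induction k) (simp_all add: mpoly_var_def mult_single flip: single_add)

lemma prod_single:
  "finite A \<Longrightarrow> (\<Prod>i\<in>A. Poly_Mapping.single (h i) (1::complex)) =
     Poly_Mapping.single (\<Sum>i\<in>A. h i) 1"
  by (induction A rule: finite_induct) (simp_all add: mult_single)

lemma mpoly_subst_id [simp]:
  "mpoly_subst mpoly_var p = (p :: ('n::{finite,linorder}) mpoly)"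
proof (induction p rule: poly_mapping_add_induct)
  case (single m c)
  have "(\<Sum>i\<in>UNIV. Poly_Mapping.single i (Poly_Mapping.lookup m i)) = m"
    by (intro poly_mapping_eqI) (simp add: lookup_sum lookup_single when_def)
  then show ?case
    by (simp add: mpoly_subst_single mpoly_var_power prod_single mpoly_const_def mult_single)
qed (simp_all add: mpoly_subst_add)

text \<open>
  The natural action on polynomial functions, \<open>(w f)(v) = f (w\<^sup>-\<^sup>1 v)\<close>: the coordinate \<open>x\<^sub>i\<close> is sent
  to the linear form given by the \<open>i\<close>-th row of \<open>w\<^sup>-\<^sup>1\<close>.
\<close>

definition act_mpoly :: "'n cmat \<Rightarrow> 'n mpoly \<Rightarrow> ('n::{finite,linorder}) mpoly" where
  "act_mpoly w p = mpoly_subst (\<lambda>i. linear_poly (matrix_inv w $ i)) p"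

lemma act_mpoly_mult: "act_mpoly w (p * q) = act_mpoly w p * act_mpoly w q"
  by (simp add: act_mpoly_def mpoly_subst_mult)

lemma subst_linear_poly:
  fixes A :: "('n::{finite,linorder}) cmat"
  shows "mpoly_subst (\<lambda>i. linear_poly (A $ i)) (linear_poly b) = linear_poly (b v* A)"
proof -
  have "mpoly_subst (\<lambda>i. linear_poly (A $ i)) (linear_poly b) =
      (\<Sum>i\<in>UNIV. \<Sum>j\<in>UNIV. mpoly_const (b $ i * A $ i $ j) * mpoly_var j)"
    by (simp add: linear_poly_def mpoly_subst_sum mpoly_subst_mult sum_distrib_left
        mpoly_const_mult mult.assoc)
  also have "\<dots> = (\<Sum>j\<in>UNIV. (\<Sum>i\<in>UNIV. mpoly_const (b $ i * A $ i $ j)) * mpoly_var j)"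
    by (subst sum.swap) (simp add: sum_distrib_right)
  also have "\<dots> = linear_poly (b v* A)"
  proof -
    have "(\<Sum>i\<in>B. mpoly_const (h i)) = (mpoly_const (\<Sum>i\<in>B. h i) :: 'n mpoly)" if "finite B" for B :: "'n set" and h
      using that by (induction B rule: finite_induct) (simp_all add: mpoly_const_add)
    then show ?thesis
      by (simp add: linear_poly_def vector_matrix_mult_def mult.commute)
  qed
  finally show ?thesis .
qed

lemma act_mpoly_linear_poly:
  "act_mpoly w (linear_poly b) = linear_poly (b v* matrix_inv w)"
  by (simp add: act_mpoly_def subst_linear_poly)

lemma linear_poly_axis: "linear_poly (mat 1 $ i) = mpoly_var i"
proof -
  have "linear_poly (mat 1 $ i) = (\<Sum>j\<in>UNIV. if j = i then mpoly_var j else 0)"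
    unfolding linear_poly_def by (rule sum.cong) (auto simp: mat_def)
  then show ?thesis by simp
qed

lemma act_mpoly_eq_0_iff:
  assumes "invertible w"
  shows "act_mpoly w p = 0 \<longleftrightarrow> p = 0"
proof
  assume *: "act_mpoly w p = 0"
  have inv: "matrix_inv w ** w = mat 1"
    using assms unfolding invertible_def matrix_inv_def by (rule someI2_ex) simp
  have rows: "(matrix_inv w $ i) v* w = mat 1 $ i" for i
  proof -
    have "(matrix_inv w $ i) v* w = (matrix_inv w ** w) $ i"
      by (simp add: vec_eq_iff matrix_matrix_mult_def vector_matrix_mult_def mult.commute)
    then show ?thesis
      by (simp only: inv)
  qed
  have "mpoly_subst (\<lambda>i. linear_poly (w $ i)) (act_mpoly w p) = p"
    by (simp add: act_mpoly_def mpoly_subst_subst subst_linear_poly rows linear_poly_axis)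
  then show "p = 0"
    using * mpoly_subst_zero by metis
qed (simp add: act_mpoly_def)

text \<open>The guard makes the extension to fractions total; only invertible matrices matter.\<close>

lift_definition act_mfrac :: "'n cmat \<Rightarrow> 'n mfrac \<Rightarrow> ('n::{finite,linorder}) mfrac"
  is "\<lambda>w (a, b). if invertible w then (act_mpoly w a, act_mpoly w b) else (0, 1)"
proof (simp split del: if_split, elim conjE)
  fix w :: "'n cmat" and x y :: "'n mpoly \<times> 'n mpoly"
  assume nz: "snd x \<noteq> 0" "snd y \<noteq> 0" and eq: "fst x * snd y = fst y * snd x"
  let ?F = "\<lambda>(a, b). if invertible w then (act_mpoly w a, act_mpoly w b) else (0, 1)"
  show "snd (?F x) \<noteq> 0 \<and> snd (?F y) \<noteq> 0 \<and> fst (?F x) * snd (?F y) = fst (?F y) * snd (?F x)"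
  proof (cases "invertible w")
    case True
    then have "act_mpoly w (snd x) \<noteq> 0" "act_mpoly w (snd y) \<noteq> 0"
      using nz by (simp_all add: act_mpoly_eq_0_iff)
    moreover have "act_mpoly w (fst x) * act_mpoly w (snd y) = act_mpoly w (fst y) * act_mpoly w (snd x)"
      using eq by (metis act_mpoly_mult)
    ultimately show ?thesis
      using True by (simp add: case_prod_beta)
  qed (simp add: case_prod_beta)
qed

lemma act_mfrac_Fract:
  assumes "invertible w" "b \<noteq> 0"
  shows "act_mfrac w (Fract a b) = Fract (act_mpoly w a) (act_mpoly w b)"
  using assms by (transfer fixing: w a b) (simp add: act_mpoly_eq_0_iff)

section \<open>Complex reflection groups\<close>

definition GL :: "(('n::finite) cmat) monoid" where
  "GL = \<lparr>carrier = {A. invertible A}, monoid.mult = (**), one = mat 1\<rparr>"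

lemma group_GL: "group (GL :: (('n::finite) cmat) monoid)"
proof (rule groupI)
  fix A :: "'n cmat" assume "A \<in> carrier GL"
  then obtain B where "A ** B = mat 1" "B ** A = mat 1"
    by (auto simp: GL_def invertible_def)
  then show "\<exists>B\<in>carrier GL. B \<otimes>\<^bsub>GL\<^esub> A = \<one>\<^bsub>GL\<^esub>"
    by (auto simp: GL_def invertible_def)
next
  show "\<one>\<^bsub>GL\<^esub> \<in> carrier (GL :: 'n cmat monoid)"
    by (auto simp: GL_def invertible_def intro!: exI[of _ "mat 1"])
qed (auto simp: GL_def invertible_mult matrix_mul_assoc)

definition fixed_space :: "'n cmat \<Rightarrow> (('n::finite) cvec) set" where
  "fixed_space r = {v. r *v v = v}"

definition is_reflection :: "('n::finite) cmat \<Rightarrow> bool" where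
  "is_reflection r \<longleftrightarrow> invertible r \<and> (\<exists>k::nat. 0 < k \<and> r [^]\<^bsub>GL\<^esub> k = \<one>\<^bsub>GL\<^esub>) \<and>
     vec.dim (fixed_space r) + 1 = CARD('n)"

definition irreducible_group :: "(('n::finite) cmat) set \<Rightarrow> bool" where
  "irreducible_group W \<longleftrightarrow>
     (\<forall>U. vec.subspace U \<and> (\<forall>w\<in>W. \<forall>u\<in>U. w *v u \<in> U) \<longrightarrow> U = {0} \<or> U = UNIV)"

definition irreducible_reflection_group :: "(('n::finite) cmat) set \<Rightarrow> bool" where
  "irreducible_reflection_group W \<longleftrightarrow>
     finite W \<and> subgroup W GL \<and> W = generate GL {r \<in> W. is_reflection r} \<and> irreducible_group W"

definition well_generated :: "(('n::finite) cmat) set \<Rightarrow> bool" where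
  "well_generated W \<longleftrightarrow>
     (\<exists>R\<subseteq>{r \<in> W. is_reflection r}. card R = CARD('n) \<and> W = generate GL R)"

definition refl_arrangement :: "(('n::finite) cmat) set \<Rightarrow> 'n cvec set set" where
  "refl_arrangement W = fixed_space ` {r \<in> W. is_reflection r}"

definition order_mult :: "(('n::finite) cmat) set \<Rightarrow> 'n cvec set \<Rightarrow> int" where
  "order_mult W H = int (card {w \<in> W. \<forall>v\<in>H. w *v v = v})"

section \<open>Hermitian inner products\<close>

definition hermitian_inner_product :: "('n cvec \<Rightarrow> ('n::finite) cvec \<Rightarrow> complex) \<Rightarrow> bool" where
  "hermitian_inner_product I \<longleftrightarrow>
     (\<forall>u u' v. I (u + u') v = I u v + I u' v) \<and>
     (\<forall>c u v. I (c *s u) v = c * I u v) \<and>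
     (\<forall>u v. I v u = cnj (I u v)) \<and>
     (\<forall>v. v \<noteq> 0 \<longrightarrow> Re (I v v) > 0)"

definition invariant_form ::
    "(('n::finite) cmat) set \<Rightarrow> ('n cvec \<Rightarrow> 'n cvec \<Rightarrow> complex) \<Rightarrow> bool" where
  "invariant_form W I \<longleftrightarrow> (\<forall>w\<in>W. \<forall>u v. I (w *v u) (w *v v) = I u v)"

definition linear_form :: "'n cvec \<Rightarrow> ('n::finite) cvec \<Rightarrow> complex" where
  "linear_form a v = (\<Sum>i\<in>UNIV. a $ i * v $ i)"

text \<open>The vector \<open>u\<close> representing the form \<open>a\<close> as \<open>v \<mapsto> I v u\<close>.\<close>

definition riesz ::
    "('n cvec \<Rightarrow> ('n::finite) cvec \<Rightarrow> complex) \<Rightarrow> 'n cvec \<Rightarrow> 'n cvec" where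
  "riesz I a = (THE u. \<forall>v. linear_form a v = I v u)"

lemma riesz_ex1:
  assumes "hermitian_inner_product I"
  shows "\<exists>!u. \<forall>v. linear_form a v = I v u"
proof -
  have addl: "I (u + u') v = I u v + I u' v" and scl: "I (c *s u) v = c * I u v"
    and sym: "I v u = cnj (I u v)" and pos: "w \<noteq> 0 \<Longrightarrow> Re (I w w) > 0" for u u' v w c
    using assms unfolding hermitian_inner_product_def by blast+
  have addr: "I v (u + u') = I v u + I v u'" for u u' v
    by (metis addl sym complex_cnj_add)
  have scr: "I v (c *s u) = cnj c * I v u" for c u v
    by (metis scl sym complex_cnj_mult)
  define T :: "'a cvec \<Rightarrow> 'a cvec" where "T u = (\<chi> i. I (axis i 1) u)" for u
  have expand: "I v u = linear_form (T u) v" for u v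
  proof -
    have zl: "I 0 u = 0"
      using addl[of 0 0 u] by simp
    have "I (\<Sum>i\<in>A. v $ i *s axis i 1) u = (\<Sum>i\<in>A. v $ i * I (axis i 1) u)" if "finite A" for A
      using that by (induction A rule: finite_induct) (simp_all add: zl addl scl)
    then have "I (\<Sum>i\<in>UNIV. v $ i *s axis i 1) u = (\<Sum>i\<in>UNIV. v $ i * I (axis i 1) u)"
      by simp
    then show ?thesis
      by (simp add: basis_expansion linear_form_def T_def mult.commute)
  qed
  have scaleR_eq: "r *\<^sub>R u = complex_of_real r *s u" for r and u :: "'a cvec"
    unfolding vec_eq_iff vector_scaleR_component vector_smult_component
    by (simp add: scaleR_conv_of_real)
  have lin: "linear T"
    by (rule linearI) (simp_all add: T_def vec_eq_iff addr scaleR_eq scr)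
  have "T u = 0 \<Longrightarrow> u = 0" for u
    using expand[of u u] pos[of u] by (auto simp: linear_form_def)
  then have inj: "inj T"
    using lin linear_injective_0 by blast
  then have "surj T"
    using lin linear_inj_imp_surj by blast
  then obtain u where u: "T u = a"
    by (metis surjD)
  have "u' = u" if "\<forall>v. linear_form a v = I v u'" for u'
  proof -
    have "I v (u' + (-1) *s u) = 0" for v
    proof -
      have "I v (u' + (-1) *s u) = I v u' + cnj (-1) * I v u"
        by (simp only: addr scr)
      also have "\<dots> = 0"
        using that expand[of v u] u by simp
      finally show ?thesis .
    qed
    then have "u' + (-1) *s u = 0"
      using pos by fastforce
    then show ?thesis
      by simp
  qed
  then show ?thesis
    using expand u by metis
qed

text \<open>
  The order of the arguments on the right makes the induced form linear in the first argument,
  since the representing vector depends conjugate-linearly on the form.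
\<close>

definition dual_form ::
    "('n cvec \<Rightarrow> ('n::finite) cvec \<Rightarrow> complex) \<Rightarrow> 'n cvec \<Rightarrow> 'n cvec \<Rightarrow> complex" where
  "dual_form I a b = I (riesz I b) (riesz I a)"

definition defining_forms ::
    "(('n::finite) cmat) set \<Rightarrow> ('n cvec \<Rightarrow> 'n cvec \<Rightarrow> complex) \<Rightarrow>
     ('n cvec set \<Rightarrow> 'n cvec) \<Rightarrow> bool" where
  "defining_forms W I \<alpha> \<longleftrightarrow> (\<forall>H\<in>refl_arrangement W.
     H = {v. linear_form (\<alpha> H) v = 0} \<and> dual_form I (\<alpha> H) (\<alpha> H) = 1)"

section \<open>Derivations\<close>

text \<open>
  The vector \<open>\<theta>\<close> stands for the derivation with coefficient \<open>\<theta> $ i\<close> at the \<open>i\<close>-th partial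
  derivative.
\<close>

type_synonym 'n der = "('n mfrac, 'n) vec"

definition der_apply :: "('n::{finite,linorder}) der \<Rightarrow> 'n mfrac \<Rightarrow> 'n mfrac" where
  "der_apply \<theta> f = (\<Sum>i\<in>UNIV. \<theta> $ i * mfrac_pderiv i f)"

definition der_scale :: "('n::{finite,linorder}) mpoly \<Rightarrow> 'n der \<Rightarrow> 'n der" where
  "der_scale s \<theta> = (\<chi> i. to_mfrac s * \<theta> $ i)"

global_interpretation der: Modules.module der_scale
  defines der_subspace = der.subspace and der_span = der.span and der_dependent = der.dependent
  by unfold_locales
    (simp_all add: der_scale_def to_mfrac_add to_mfrac_mult vec_eq_iff algebra_simps)

definition free_submodule :: "(('n::{finite,linorder}) der) set \<Rightarrow> bool" where
  "free_submodule M \<longleftrightarrow> (\<exists>B. \<not> der.dependent B \<and> der.span B = M)"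

text \<open>
  An isomorphism of \<open>S\<close>-modules between two subsets \<open>M\<close> and \<open>N\<close>, which are required to be
  submodules; the map is only constrained on \<open>M\<close>.
\<close>

definition submodule_iso ::
    "(('n::{finite,linorder}) der \<Rightarrow> 'n der) \<Rightarrow> 'n der set \<Rightarrow> 'n der set \<Rightarrow> bool" where
  "submodule_iso \<phi> M N \<longleftrightarrow> der.subspace M \<and> der.subspace N \<and> bij_betw \<phi> M N \<and>
     (\<forall>x\<in>M. \<forall>y\<in>M. \<phi> (x + y) = \<phi> x + \<phi> y) \<and>
     (\<forall>s. \<forall>x\<in>M. \<phi> (der_scale s x) = der_scale s (\<phi> x))"

definition der_invariant :: "'n cmat set \<Rightarrow> ('n::{finite,linorder}) der \<Rightarrow> bool" where
  "der_invariant W \<theta> \<longleftrightarrow>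
     (\<forall>w\<in>W. \<forall>f. act_mfrac w (der_apply \<theta> (act_mfrac (matrix_inv w) f)) = der_apply \<theta> f)"

definition has_pdeg :: "('n::{finite,linorder}) der \<Rightarrow> int \<Rightarrow> bool" where
  "has_pdeg \<theta> d \<longleftrightarrow> (\<exists>p q f g. d = int p - int q \<and>
     (\<forall>i. homogeneous_mpoly p (f i) \<and> homogeneous_mpoly q (g i) \<and> g i \<noteq> 0 \<and>
        \<theta> $ i = Fract (f i) (g i)))"

definition homogeneous_der :: "('n::{finite,linorder}) der \<Rightarrow> bool" where
  "homogeneous_der \<theta> \<longleftrightarrow> (\<exists>d. has_pdeg \<theta> d)"

definition nabla :: "('n::{finite,linorder}) der \<Rightarrow> 'n der \<Rightarrow> 'n der" where
  "nabla \<theta> \<zeta> = (\<chi> i. der_apply \<theta> (\<zeta> $ i))"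

section \<open>Multi-derivation modules\<close>

definition Der_S :: "(('n::{finite,linorder}) der) set" where
  "Der_S = {\<theta>. \<forall>i. \<theta> $ i \<in> range to_mfrac}"

text \<open>The denominators are nonzero since everything divides \<open>0\<close>.\<close>

definition local_ring :: "'n cvec \<Rightarrow> (('n::{finite,linorder}) mfrac) set" where
  "local_ring a = {Fract f g | f g. \<not> linear_poly a dvd g}"

definition arr_poly ::
    "'n cmat set \<Rightarrow> ('n cvec set \<Rightarrow> 'n cvec) \<Rightarrow>
     ('n::{finite,linorder}) mpoly" where
  "arr_poly W \<alpha> = (\<Prod>H\<in>refl_arrangement W. linear_poly (\<alpha> H))"

definition Der_S' ::
    "'n cmat set \<Rightarrow> ('n cvec set \<Rightarrow> 'n cvec) \<Rightarrow>
     (('n::{finite,linorder}) der) set" where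
  "Der_S' W \<alpha> = {\<theta>. \<forall>i. \<exists>f k. \<theta> $ i = Fract f (arr_poly W \<alpha> ^ k)}"

definition D_minus_infinity ::
    "'n cmat set \<Rightarrow> ('n cvec \<Rightarrow> 'n cvec \<Rightarrow> complex) \<Rightarrow>
     ('n cvec set \<Rightarrow> 'n cvec) \<Rightarrow> (('n::{finite,linorder}) der) set" where
  "D_minus_infinity W I \<alpha> = {\<theta> \<in> Der_S' W \<alpha>. \<forall>H\<in>refl_arrangement W. \<forall>\<beta>.
     dual_form I (\<alpha> H) \<beta> = 0 \<longrightarrow>
     der_apply \<theta> (to_mfrac (linear_poly \<beta>)) \<in> local_ring (\<alpha> H)}"

definition D_mult ::
    "'n cmat set \<Rightarrow> ('n cvec \<Rightarrow> 'n cvec \<Rightarrow> complex) \<Rightarrow>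
     ('n cvec set \<Rightarrow> 'n cvec) \<Rightarrow> ('n cvec set \<Rightarrow> int) \<Rightarrow>
     (('n::{finite,linorder}) der) set" where
  "D_mult W I \<alpha> \<nu> = {\<theta> \<in> D_minus_infinity W I \<alpha>. \<forall>H\<in>refl_arrangement W.
     \<exists>u\<in>local_ring (\<alpha> H).
       der_apply \<theta> (to_mfrac (linear_poly (\<alpha> H))) =
       to_mfrac (linear_poly (\<alpha> H)) powi \<nu> H * u}"

definition universal ::
    "'n cmat set \<Rightarrow> ('n cvec \<Rightarrow> 'n cvec \<Rightarrow> complex) \<Rightarrow>
     ('n cvec set \<Rightarrow> 'n cvec) \<Rightarrow> ('n cvec set \<Rightarrow> int) \<Rightarrow>
     ('n::{finite,linorder}) der \<Rightarrow> bool" where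
  "universal W I \<alpha> \<nu> \<zeta> \<longleftrightarrow> homogeneous_der \<zeta> \<and> \<zeta> \<in> D_minus_infinity W I \<alpha> \<and>
     submodule_iso (\<lambda>\<theta>. nabla \<theta> \<zeta>) Der_S (D_mult W I \<alpha> \<nu>)"

end

theory Submission
  imports Defs
begin

text \<open>
  Write \<open>\<Phi> \<theta>\<close> for \<open>nabla \<theta> \<zeta>\<close>. It is linear over the whole fraction field, and the
  universality of \<open>\<zeta>\<close> makes it injective there. Membership in \<open>D_mult\<close> means that the
  coefficients are polynomials divided by powers of the arrangement polynomial \<open>Q\<close>, together
  with one condition (\<open>local_der\<close>) for each hyperplane. Since \<open>\<Phi>\<close> maps \<open>Der_S\<close> onto
  \<open>D_mult\<close> for \<open>\<nu>\<close>, inverting \<open>Q\<close> shows that \<open>\<Phi>\<close> permutes the derivations with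
  coefficients in \<open>S[1/Q]\<close>. So the theorem becomes a statement about one hyperplane \<open>H\<close> at a
  time: \<open>\<theta>\<close> satisfies the condition for \<open>\<mu> H\<close> if and only if \<open>\<Phi> \<theta>\<close> satisfies the one for
  \<open>\<nu> H + \<mu> H\<close> (\<open>nabla_local_der_iff\<close>).

  Fix \<open>H\<close>, let \<open>R\<close> be the local ring at \<open>H\<close>, let \<open>t\<close> be the linear form of \<open>H\<close>, and let \<open>r\<close>
  be the vector orthogonal to \<open>H\<close> with \<open>t(r) = 1\<close>. A linear form \<open>b\<close> is orthogonal to \<open>t\<close>
  exactly if \<open>b(r) = 0\<close>. Let \<open>\<delta>\<close> be the derivative in direction \<open>r\<close>, put \<open>z = \<zeta>(t)\<close> and
  let \<open>e\<close> be the order of the pointwise stabilizer of \<open>H\<close>. Three facts carry the proof.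

  \<^item> \<open>\<delta> (\<zeta> b) \<in> t^(e-1) R\<close> for \<open>b(r) = 0\<close>. The function \<open>\<zeta> b\<close> is regular at \<open>H\<close> and invariant
    under the stabilizer, so its normal derivative is a semi-invariant. The stabilizer acts
    trivially on the residue field of \<open>R\<close> and multiplies \<open>t\<close> by \<open>e\<close> distinct numbers, whence a
    semi-invariant of this character has order \<open>-1\<close> modulo \<open>e\<close>
    (\<open>normal_derivative_tangential\<close>).
  \<^item> \<open>z \<in> t^(\<nu>+1) R\<close>. The derivative \<open>\<delta> z\<close> lies in \<open>t^\<nu> R\<close> because it is the normal component of
    \<open>\<Phi> \<delta>\<close>, and differentiation lowers a nonzero order by exactly one. The order \<open>0\<close> cannot
    occur, since \<open>z\<close> transforms like \<open>t\<close> (\<open>z_mem\<close>).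
  \<^item> \<open>\<delta> z\<close> generates \<open>t^\<nu> R\<close>. Otherwise the second fact would force the normal components
    of \<open>\<Phi>\<close> on regular derivations into \<open>t^(\<nu>+1) R\<close>, against surjectivity (\<open>\<delta>z_not_mem\<close>).

  Decompose \<open>\<theta> = \<theta>(t) \<delta> + \<tau>\<close> with \<open>\<tau>(t) = 0\<close>. The second fact lets \<open>\<tau>\<close> contribute only
  \<open>t^(\<nu>+1) R\<close> to the normal component of \<open>\<Phi> \<theta>\<close>, which is harmless as long as \<open>\<mu> \<le> 1\<close>. The
  first fact absorbs the poles of \<open>\<theta>(t)\<close> in the tangential components as long as
  \<open>\<mu> \<ge> 1 - e\<close>. The third one allows the normal component of \<open>\<Phi> \<theta>\<close> to be cancelled by a
  multiple of \<open>\<Phi> \<delta>\<close>, which reduces the converse to the case of multiplicity \<open>0\<close>, that is,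
  to universality.
\<close>

section \<open>Derivations of the fraction field\<close>

lemma to_mfrac_0 [simp]: "to_mfrac 0 = 0"
  by (simp add: to_mfrac_def Zero_fract_def)

lemma to_mfrac_minus: "to_mfrac (- p) = - to_mfrac p"
  by (simp add: to_mfrac_def)

lemma to_mfrac_diff: "to_mfrac (p - q) = to_mfrac p - to_mfrac q"
  by (simp add: to_mfrac_def)

lemma to_mfrac_sum: "to_mfrac (\<Sum>i\<in>A. f i) = (\<Sum>i\<in>A. to_mfrac (f i))"
  by (induction A rule: infinite_finite_induct) (simp_all add: to_mfrac_add)

lemma to_mfrac_power: "to_mfrac (p ^ k) = to_mfrac p ^ k"
  by (induction k) (simp_all add: to_mfrac_mult)

lemma to_mfrac_eq_iff [simp]: "to_mfrac p = to_mfrac q \<longleftrightarrow> p = q"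
  by (simp add: to_mfrac_def eq_fract)

lemma to_mfrac_eq_0_iff [simp]: "to_mfrac p = 0 \<longleftrightarrow> p = 0"
  using to_mfrac_eq_iff[of p 0] by (simp del: to_mfrac_eq_iff)

lemma Fract_to_mfrac: "Fract p q = to_mfrac p / to_mfrac q"
  by (simp add: to_mfrac_def divide_fract)

lemma mfrac_cases:
  obtains p q where "q \<noteq> 0" "f = to_mfrac p / to_mfrac q"
  by (cases f rule: Fract_cases) (auto simp: Fract_to_mfrac)

abbreviation cst :: "complex \<Rightarrow> ('n::{finite,linorder}) mfrac" where
  "cst c \<equiv> to_mfrac (mpoly_const c)"

lemma mpoly_const_eq_0_iff [simp]: "(mpoly_const c :: 'n mpoly) = 0 \<longleftrightarrow> c = 0"
proof
  assume 0: "(mpoly_const c :: 'n mpoly) = 0"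
  have "c = Poly_Mapping.lookup (mpoly_const c :: 'n mpoly) 0"
    by (simp add: mpoly_const_def)
  then show "c = 0"
    unfolding 0 by simp
qed simp

lemma mpoly_const_minus: "mpoly_const (- a) = - mpoly_const a"
  using mpoly_const_add[of a "- a"] by (simp add: eq_neg_iff_add_eq_0 add.commute)

lemma mpoly_const_diff: "mpoly_const (a - b) = mpoly_const a - mpoly_const b"
  using mpoly_const_add[of a "- b"] by (simp add: mpoly_const_minus)

lemma mpoly_const_power: "mpoly_const (a ^ k) = mpoly_const a ^ k"
  by (induction k) (simp_all add: mpoly_const_mult)

lemma mpoly_const_sum: "mpoly_const (\<Sum>i\<in>A. h i) = (\<Sum>i\<in>A. mpoly_const (h i))"
  by (induction A rule: infinite_finite_induct) (simp_all add: mpoly_const_add)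

lemma mpoly_pderiv_const [simp]: "mpoly_pderiv i (mpoly_const c) = 0"
  by (simp add: mpoly_const_def mpoly_pderiv_single)

lemma mpoly_pderiv_var: "mpoly_pderiv i (mpoly_var j) = (if i = j then 1 else 0)"
  by (simp add: mpoly_var_def mpoly_pderiv_single lookup_single when_def)

lemma linear_poly_eq_0_iff: "linear_poly a = 0 \<longleftrightarrow> a = 0"
proof
  assume 0: "linear_poly a = 0"
  have "mpoly_pderiv i (linear_poly a) = mpoly_const (a $ i)" for i
  proof -
    have "mpoly_pderiv i (\<Sum>j\<in>B. mpoly_const (a $ j) * mpoly_var j) =
        (\<Sum>j\<in>B. mpoly_pderiv i (mpoly_const (a $ j) * mpoly_var j))" for B
      by (induction B rule: infinite_finite_induct) (simp_all add: mpoly_pderiv_add)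
    then show ?thesis
      by (simp add: linear_poly_def mpoly_pderiv_mult mpoly_pderiv_var if_distrib cong: if_cong)
  qed
  then have "a $ i = 0" for i
    using 0 by (metis mpoly_const_eq_0_iff mpoly_pderiv_zero)
  then show "a = 0"
    by (simp add: vec_eq_iff)
qed (simp add: linear_poly_def)

lemma mpoly_induct [case_names const var add mult]:
  fixes p :: "('n::{finite,linorder}) mpoly"
  assumes const: "\<And>c. P (mpoly_const c)"
    and var: "\<And>i. P (mpoly_var i)"
    and add: "\<And>p q. P p \<Longrightarrow> P q \<Longrightarrow> P (p + q)"
    and mult: "\<And>p q. P p \<Longrightarrow> P q \<Longrightarrow> P (p * q)"
  shows "P p"
proof (induction p rule: poly_mapping_add_induct)
  case zero
  show ?case using const[of 0] by simp
next
  case (single m c)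
  have one: "P 1" using const[of 1] by simp
  have pow: "P (mpoly_var i ^ k)" for i k
    by (induction k) (simp_all add: one var mult)
  have "P (\<Prod>i\<in>A. mpoly_var i ^ Poly_Mapping.lookup m i)" if "finite A" for A
    using that by (induction A rule: finite_induct) (simp_all add: one pow mult)
  then have "P (mpoly_const c * (\<Prod>i\<in>UNIV. mpoly_var i ^ Poly_Mapping.lookup m i))"
    by (intro mult const) simp
  then show ?case
    using mpoly_subst_single[of mpoly_var m c] by simp
qed (rule add)

lemma mfrac_pderiv_to_mfrac: "mfrac_pderiv i (to_mfrac p) = to_mfrac (mpoly_pderiv i p)"
  using mpoly_pderiv_const[of i 1]
  by (simp add: to_mfrac_def mfrac_pderiv_Fract del: mpoly_pderiv_const)

lemma mfrac_pderiv_quotient: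
  assumes "q \<noteq> 0"
  shows "mfrac_pderiv i (to_mfrac p / to_mfrac q) =
    (to_mfrac (mpoly_pderiv i p) * to_mfrac q - to_mfrac p * to_mfrac (mpoly_pderiv i q)) /
    (to_mfrac q * to_mfrac q)"
  unfolding Fract_to_mfrac[symmetric] mfrac_pderiv_Fract[OF assms]
  unfolding Fract_to_mfrac to_mfrac_diff to_mfrac_mult ..

lemma quotient_rule_add:
  fixes a b c d a' b' c' d' :: "'a::field"
  assumes "b \<noteq> 0" "d \<noteq> 0"
  shows "((a' * d + a * d' + (c' * b + c * b')) * (b * d) - (a * d + c * b) * (b' * d + b * d')) / ((b * d) * (b * d)) =
    (a' * b - a * b') / (b * b) + (c' * d - c * d') / (d * d)"
  using assms by (simp add: divide_simps) algebra

lemma quotient_rule_mult: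
  fixes a b c d a' b' c' d' :: "'a::field"
  assumes "b \<noteq> 0" "d \<noteq> 0"
  shows "((a' * c + a * c') * (b * d) - (a * c) * (b' * d + b * d')) / ((b * d) * (b * d)) =
    (a' * b - a * b') / (b * b) * (c / d) + a / b * ((c' * d - c * d') / (d * d))"
  using assms by (simp add: divide_simps) algebra

lemma mfrac_pderiv_add: "mfrac_pderiv i (f + g) = mfrac_pderiv i f + mfrac_pderiv i g"
proof -
  obtain a b where b: "b \<noteq> 0" and f: "f = to_mfrac a / to_mfrac b" by (rule mfrac_cases)
  obtain c d where d: "d \<noteq> 0" and g: "g = to_mfrac c / to_mfrac d" by (rule mfrac_cases)
  have nz: "to_mfrac b \<noteq> 0" "to_mfrac d \<noteq> 0" "b * d \<noteq> 0"
    using b d by simp_all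
  have eq: "f + g = to_mfrac (a * d + c * b) / to_mfrac (b * d)"
    unfolding f g to_mfrac_add to_mfrac_mult by (rule add_frac_eq[OF nz(1,2)])
  show ?thesis
    unfolding eq mfrac_pderiv_quotient[OF nz(3)]
    unfolding mpoly_pderiv_add mpoly_pderiv_mult
      to_mfrac_add to_mfrac_mult quotient_rule_add[OF nz(1,2)]
    unfolding f g mfrac_pderiv_quotient[OF b] mfrac_pderiv_quotient[OF d] ..
qed

lemma mfrac_pderiv_mult: "mfrac_pderiv i (f * g) = mfrac_pderiv i f * g + f * mfrac_pderiv i g"
proof -
  obtain a b where b: "b \<noteq> 0" and f: "f = to_mfrac a / to_mfrac b" by (rule mfrac_cases)
  obtain c d where d: "d \<noteq> 0" and g: "g = to_mfrac c / to_mfrac d" by (rule mfrac_cases)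
  have nz: "to_mfrac b \<noteq> 0" "to_mfrac d \<noteq> 0" "b * d \<noteq> 0"
    using b d by simp_all
  have eq: "f * g = to_mfrac (a * c) / to_mfrac (b * d)"
    unfolding f g to_mfrac_mult by (rule times_divide_times_eq)
  show ?thesis
    unfolding eq mfrac_pderiv_quotient[OF nz(3)]
    unfolding mpoly_pderiv_mult
      to_mfrac_add to_mfrac_mult quotient_rule_mult[OF nz(1,2)]
    unfolding f g mfrac_pderiv_quotient[OF b] mfrac_pderiv_quotient[OF d] ..
qed

lemma der_apply_add: "der_apply \<theta> (f + g) = der_apply \<theta> f + der_apply \<theta> g"
  by (simp add: der_apply_def mfrac_pderiv_add sum.distrib algebra_simps)

lemma der_apply_mult: "der_apply \<theta> (f * g) = der_apply \<theta> f * g + f * der_apply \<theta> g"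
  by (simp add: der_apply_def mfrac_pderiv_mult sum.distrib sum_distrib_left algebra_simps)

lemma der_apply_cst [simp]: "der_apply \<theta> (cst c) = 0"
  by (simp add: der_apply_def mfrac_pderiv_to_mfrac)

lemma der_apply_0 [simp]: "der_apply \<theta> 0 = 0"
  using der_apply_cst[of \<theta> 0] by (simp del: der_apply_cst)

lemma der_apply_1 [simp]: "der_apply \<theta> 1 = 0"
  using der_apply_cst[of \<theta> 1] by (simp del: der_apply_cst)

lemma der_apply_minus: "der_apply \<theta> (- f) = - der_apply \<theta> f"
  using der_apply_add[of \<theta> f "- f"] by (simp add: eq_neg_iff_add_eq_0 add.commute)

lemma der_apply_diff: "der_apply \<theta> (f - g) = der_apply \<theta> f - der_apply \<theta> g"
  using der_apply_add[of \<theta> f "- g"] by (simp add: der_apply_minus)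

lemma der_apply_sum: "der_apply \<theta> (\<Sum>i\<in>A. f i) = (\<Sum>i\<in>A. der_apply \<theta> (f i))"
  by (induction A rule: infinite_finite_induct) (simp_all add: der_apply_add)

text \<open>
  The power rule multiplied by \<open>f\<close>, which avoids the exponent \<open>k - 1\<close> and passes to inverses
  directly.
\<close>

lemma der_apply_powi:
  assumes "f \<noteq> 0"
  shows "der_apply \<theta> (f powi k) * f = of_int k * f powi k * der_apply \<theta> f"
proof -
  have pos: "der_apply \<theta> (f ^ n) * f = of_nat n * f ^ n * der_apply \<theta> f" for n
    by (induction n) (simp_all add: der_apply_mult algebra_simps)
  show ?thesis
  proof (cases k rule: int_cases2)
    case (nonneg n)
    then show ?thesis using pos[of n] by simp
  next
    case (nonpos n)
    define p q where "p = f ^ n" and "q = f powi k"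
    have pq: "p * q = 1" "p \<noteq> 0"
      using assms by (simp_all add: p_def q_def nonpos power_int_minus)
    have "der_apply \<theta> p * q + p * der_apply \<theta> q = 0"
      using der_apply_mult[of \<theta> p q] pq by simp
    then have "(der_apply \<theta> p * q + p * der_apply \<theta> q) * f = 0"
      by simp
    then have "der_apply \<theta> p * f * q + p * (der_apply \<theta> q * f) = 0"
      by (simp only: ac_simps distrib_left distrib_right)
    then have "p * (of_nat n * q * der_apply \<theta> f + der_apply \<theta> q * f) = 0"
      unfolding pos[of n, folded p_def] by (simp only: ac_simps distrib_left distrib_right)
    then have "der_apply \<theta> q * f = - (of_nat n * q * der_apply \<theta> f)"
      using pq(2) by (simp add: eq_neg_iff_add_eq_0 add.commute)
    then show ?thesis
      by (simp add: q_def[symmetric]) (simp add: nonpos)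
  qed
qed

lemma der_apply_der_add: "der_apply (\<theta> + \<eta>) f = der_apply \<theta> f + der_apply \<eta> f"
  by (simp add: der_apply_def sum.distrib algebra_simps)

lemma der_apply_der_smult: "der_apply (x *s \<theta>) f = x * der_apply \<theta> f"
  by (simp add: der_apply_def sum_distrib_left algebra_simps)

lemma der_scale_smult: "der_scale s \<theta> = to_mfrac s *s \<theta>"
  by (simp add: der_scale_def vec_eq_iff)

abbreviation lin :: "'n cvec \<Rightarrow> ('n::{finite,linorder}) mfrac" where
  "lin b \<equiv> to_mfrac (linear_poly b)"

lemma lin_altdef: "lin b = (\<Sum>i\<in>UNIV. cst (b $ i) * to_mfrac (mpoly_var i))"
  by (simp add: linear_poly_def to_mfrac_sum to_mfrac_mult)

lemma der_apply_var: "der_apply \<theta> (to_mfrac (mpoly_var i)) = \<theta> $ i"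
  by (simp add: der_apply_def mfrac_pderiv_to_mfrac mpoly_pderiv_var if_distrib cong: if_cong)

lemma der_apply_lin: "der_apply \<theta> (lin b) = (\<Sum>i\<in>UNIV. cst (b $ i) * \<theta> $ i)"
  by (simp add: lin_altdef der_apply_sum der_apply_mult der_apply_var)

lemma nabla_nth: "nabla \<theta> \<zeta> $ i = der_apply \<theta> (\<zeta> $ i)"
  by (simp add: nabla_def)

lemma nabla_lin: "der_apply (nabla \<theta> \<zeta>) (lin b) = der_apply \<theta> (der_apply \<zeta> (lin b))"
  by (simp add: der_apply_lin nabla_nth der_apply_sum der_apply_mult)

lemma nabla_add: "nabla (\<theta> + \<eta>) \<zeta> = nabla \<theta> \<zeta> + nabla \<eta> \<zeta>"
  by (simp add: vec_eq_iff nabla_nth der_apply_der_add)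

lemma nabla_smult: "nabla (x *s \<theta>) \<zeta> = x *s nabla \<theta> \<zeta>"
  by (simp add: vec_eq_iff nabla_nth der_apply_der_smult)

lemma der_apply_der_diff: "der_apply (\<theta> - \<eta>) f = der_apply \<theta> f - der_apply \<eta> f"
  using der_apply_der_add[of "\<theta> - \<eta>" \<eta> f] by simp

lemma nabla_diff: "nabla (\<theta> - \<eta>) \<zeta> = nabla \<theta> \<zeta> - nabla \<eta> \<zeta>"
  by (simp add: vec_eq_iff nabla_nth der_apply_der_diff)

lemma linear_poly_add_smult:
  "linear_poly (u + x *s v) = linear_poly u + mpoly_const x * linear_poly v"
  by (simp add: linear_poly_def mpoly_const_add mpoly_const_mult distrib_right sum.distrib
      sum_distrib_left mult.assoc)

lemma linear_poly_diff_smult: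
  "linear_poly (u - x *s v) = linear_poly u - mpoly_const x * linear_poly v"
  using linear_poly_add_smult[of u "- x" v] by (simp add: mpoly_const_minus)

lemma linear_form_diff_smult:
  "linear_form (u - x *s v) y = linear_form u y - x * linear_form v y"
  by (simp add: linear_form_def left_diff_distrib sum_subtractf sum_distrib_left mult.assoc)

lemma linear_form_axis [simp]: "linear_form (axis i 1) v = v $ i"
  by (simp add: linear_form_def axis_def if_distrib[of "\<lambda>x. x * _"] cong: if_cong)

lemma linear_form_add_right:
  "linear_form a (u + x *s v) = linear_form a u + x * linear_form a v"
  by (simp add: linear_form_def distrib_left sum.distrib sum_distrib_left mult_ac)

lemma linear_form_diff_right:
  "linear_form a (u - x *s v) = linear_form a u - x * linear_form a v"
  using linear_form_add_right[of a u "- x" v] by simp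

section \<open>Fractional ideals along a hyperplane\<close>

text \<open>
  The elements of order at least \<open>k\<close> along the hyperplane. Working with these fractional
  ideals avoids a valuation: the order estimates below are proved by raising \<open>k\<close> one step at
  a time.
\<close>

definition frac_ideal :: "'n cvec \<Rightarrow> int \<Rightarrow> (('n::{finite,linorder}) mfrac) set" where
  "frac_ideal a k = {lin a powi k * u | u. u \<in> local_ring a}"

text \<open>
  The vector \<open>r\<close> selects a complement of the hyperplane \<open>a = 0\<close>. Relative to it, every
  reflection fixing the hyperplane and preserving the line of \<open>r\<close> is a homothety of that line.
\<close>

locale hyperplane =
  fixes a r :: "('n::{finite,linorder}) cvec"
  assumes normalized: "linear_form a r = 1"
begin

abbreviation "R \<equiv> local_ring a"
abbreviation "t \<equiv> lin a"

text \<open>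
  The substitution induced by the linear map that is the identity on the hyperplane and
  multiplies \<open>r\<close> by \<open>c\<close>. For \<open>c = 0\<close> it is restriction to the hyperplane followed by
  extension along \<open>r\<close>.
\<close>

definition homothety :: "complex \<Rightarrow> 'n mpoly \<Rightarrow> 'n mpoly" where
  "homothety c = mpoly_subst (\<lambda>i. mpoly_var i + mpoly_const ((c - 1) * r $ i) * linear_poly a)"

lemma homothety_linear_poly:
  "homothety c (linear_poly b) = linear_poly b + mpoly_const ((c - 1) * linear_form b r) * linear_poly a"
proof -
  have "homothety c (linear_poly b) =
      (\<Sum>i\<in>UNIV. mpoly_const (b $ i) * (mpoly_var i + mpoly_const ((c - 1) * r $ i) * linear_poly a))"
    by (simp add: homothety_def linear_poly_def[of b] mpoly_subst_sum mpoly_subst_mult)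
  also have "\<dots> = linear_poly b +
      (\<Sum>i\<in>UNIV. mpoly_const (b $ i) * mpoly_const ((c - 1) * r $ i)) * linear_poly a"
    by (simp add: distrib_left sum.distrib linear_poly_def[of b] sum_distrib_right mult.assoc)
  also have "(\<Sum>i\<in>UNIV. mpoly_const (b $ i) * mpoly_const ((c - 1) * r $ i)) =
      (mpoly_const ((c - 1) * linear_form b r) :: 'n mpoly)"
    unfolding linear_form_def mpoly_const_mult[symmetric] mpoly_const_sum[symmetric] sum_distrib_left
    by (simp add: mult_ac)
  finally show ?thesis .
qed

lemma homothety_normal: "homothety c (linear_poly a) = mpoly_const c * linear_poly a"
proof -
  have "mpoly_const c = 1 + (mpoly_const (c - 1) :: 'n mpoly)"
    using mpoly_const_add[of 1 "c - 1"] by simp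
  then show ?thesis
    by (simp add: homothety_linear_poly normalized distrib_right)
qed

lemma homothety_cong: "linear_poly a dvd homothety c p - p"
proof (induction p rule: mpoly_induct)
  case (const c')
  then show ?case by (simp add: homothety_def)
next
  case (var i)
  then show ?case by (simp add: homothety_def)
next
  case (add p q)
  have "homothety c (p + q) - (p + q) = (homothety c p - p) + (homothety c q - q)"
    by (simp add: homothety_def mpoly_subst_add)
  then show ?case using add by (simp only: dvd_add)
next
  case (mult p q)
  have "homothety c (p * q) - p * q = (homothety c p - p) * homothety c q + p * (homothety c q - q)"
    by (simp add: homothety_def mpoly_subst_mult algebra_simps)
  then show ?case using mult by (simp only: dvd_add dvd_mult dvd_mult2)
qed

text \<open>
  Restriction to the hyperplane is a ring homomorphism into a domain whose kernel is generated
  by the linear form, so linear forms are prime.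
\<close>

lemma linear_poly_dvd_iff: "linear_poly a dvd p \<longleftrightarrow> homothety 0 p = 0"
proof
  assume "linear_poly a dvd p"
  then obtain q where "p = linear_poly a * q" ..
  then have "homothety 0 p = homothety 0 (linear_poly a) * homothety 0 q"
    by (simp add: homothety_def mpoly_subst_mult)
  then show "homothety 0 p = 0"
    by (simp add: homothety_normal)
next
  assume "homothety 0 p = 0"
  then show "linear_poly a dvd p"
    using homothety_cong[of 0 p] by simp
qed

lemma dvd_mult_iff: "linear_poly a dvd p * q \<longleftrightarrow> linear_poly a dvd p \<or> linear_poly a dvd q"
  unfolding linear_poly_dvd_iff by (simp add: homothety_def mpoly_subst_mult)

lemma not_dvd_1: "\<not> linear_poly a dvd 1"
  by (simp add: linear_poly_dvd_iff homothety_def)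

lemma linear_poly_nonzero [simp]: "linear_poly a \<noteq> 0"
  using normalized by (auto simp: linear_poly_eq_0_iff linear_form_def)

lemma t_powi_add: "t powi (k + l) = t powi k * t powi l"
  by (rule power_int_add) simp

lemma t_powi_cancel [simp]: "t powi (- k) * t powi k = 1" "t powi k * t powi (- k) = 1"
  by (simp_all add: t_powi_add[symmetric])

lemma R_I: "\<not> linear_poly a dvd q \<Longrightarrow> to_mfrac p / to_mfrac q \<in> R"
  by (auto simp: local_ring_def Fract_to_mfrac)

lemma R_E:
  assumes "x \<in> R"
  obtains p q where "x = to_mfrac p / to_mfrac q" "\<not> linear_poly a dvd q" "q \<noteq> 0"
  using assms by (auto simp: local_ring_def Fract_to_mfrac)

lemma R_to_mfrac [simp, intro]: "to_mfrac p \<in> R"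
  using R_I[OF not_dvd_1, of p] by simp

lemma R_0 [simp, intro]: "0 \<in> R"
  using R_to_mfrac[of 0] by simp

lemma R_1 [simp, intro]: "1 \<in> R"
  using R_to_mfrac[of 1] by simp

lemma R_mult: "x \<in> R \<Longrightarrow> y \<in> R \<Longrightarrow> x * y \<in> R"
proof (elim R_E)
  fix p q p' q'
  assume "x = to_mfrac p / to_mfrac q" "y = to_mfrac p' / to_mfrac q'"
    "\<not> linear_poly a dvd q" "\<not> linear_poly a dvd q'"
  then show ?thesis
    using R_I[of "q * q'" "p * p'"] by (simp add: dvd_mult_iff to_mfrac_mult)
qed

lemma R_add: "x \<in> R \<Longrightarrow> y \<in> R \<Longrightarrow> x + y \<in> R"
proof (elim R_E)
  fix p q p' q'
  assume *: "x = to_mfrac p / to_mfrac q" "y = to_mfrac p' / to_mfrac q'"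
    "\<not> linear_poly a dvd q" "\<not> linear_poly a dvd q'" "q \<noteq> 0" "q' \<noteq> 0"
  then have "x + y = to_mfrac (p * q' + p' * q) / to_mfrac (q * q')"
    by (simp add: add_frac_eq to_mfrac_mult to_mfrac_add)
  then show ?thesis
    using * R_I[of "q * q'"] by (simp add: dvd_mult_iff)
qed

lemma R_minus: "x \<in> R \<Longrightarrow> - x \<in> R"
  using R_mult[OF R_to_mfrac, of x "- 1"] by (simp add: to_mfrac_minus)

lemma R_diff: "x \<in> R \<Longrightarrow> y \<in> R \<Longrightarrow> x - y \<in> R"
  using R_add[of x "- y"] R_minus by simp

lemma R_sum: "(\<And>i. i \<in> A \<Longrightarrow> f i \<in> R) \<Longrightarrow> (\<Sum>i\<in>A. f i) \<in> R"
  by (induction A rule: infinite_finite_induct) (auto intro: R_add)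

lemma R_power: "x \<in> R \<Longrightarrow> x ^ k \<in> R"
  by (induction k) (auto intro: R_mult)

lemma frac_ideal_0 [simp]: "frac_ideal a 0 = R"
  by (simp add: frac_ideal_def)

lemma frac_ideal_iff: "x \<in> frac_ideal a k \<longleftrightarrow> t powi (- k) * x \<in> R"
proof
  assume "x \<in> frac_ideal a k"
  then obtain u where "u \<in> R" "x = t powi k * u"
    by (auto simp: frac_ideal_def)
  then show "t powi (- k) * x \<in> R"
    by (simp only: mult.assoc[symmetric] t_powi_cancel mult_1_left)
next
  assume "t powi (- k) * x \<in> R"
  moreover have "x = t powi k * (t powi (- k) * x)"
    by (simp only: mult.assoc[symmetric] t_powi_cancel mult_1_left)
  ultimately show "x \<in> frac_ideal a k"
    unfolding frac_ideal_def by blast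
qed

lemma frac_ideal_zero [simp]: "0 \<in> frac_ideal a k"
  by (simp add: frac_ideal_iff)

lemma frac_ideal_add: "x \<in> frac_ideal a k \<Longrightarrow> y \<in> frac_ideal a k \<Longrightarrow> x + y \<in> frac_ideal a k"
  by (simp add: frac_ideal_iff distrib_left R_add)

lemma frac_ideal_diff: "x \<in> frac_ideal a k \<Longrightarrow> y \<in> frac_ideal a k \<Longrightarrow> x - y \<in> frac_ideal a k"
  by (simp add: frac_ideal_iff right_diff_distrib R_diff)

lemma frac_ideal_mult:
  assumes "x \<in> frac_ideal a k" "y \<in> frac_ideal a l"
  shows "x * y \<in> frac_ideal a (k + l)"
proof -
  have "t powi (- (k + l)) * (x * y) = (t powi (- k) * x) * (t powi (- l) * y)"
    by (simp only: minus_add_distrib t_powi_add mult_ac)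
  then show ?thesis
    using assms R_mult by (simp only: frac_ideal_iff)
qed

lemma frac_ideal_mult_R: "u \<in> R \<Longrightarrow> x \<in> frac_ideal a k \<Longrightarrow> u * x \<in> frac_ideal a k"
  using frac_ideal_mult[of u 0 x k] by simp

lemma frac_ideal_sum: "(\<And>i. i \<in> A \<Longrightarrow> f i \<in> frac_ideal a k) \<Longrightarrow> (\<Sum>i\<in>A. f i) \<in> frac_ideal a k"
  by (induction A rule: infinite_finite_induct) (auto intro: frac_ideal_add)

lemma t_powi_in [simp]: "t powi k \<in> frac_ideal a k"
  by (simp only: frac_ideal_iff t_powi_cancel R_1)

lemma t_in [simp]: "t \<in> frac_ideal a 1"
  using t_powi_in[of 1] by simp

lemma t_powi_mult_in_iff: "t powi k * x \<in> frac_ideal a (k + l) \<longleftrightarrow> x \<in> frac_ideal a l"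
  unfolding frac_ideal_iff mult.assoc[symmetric] t_powi_add[symmetric] by simp

lemma frac_ideal_mono:
  assumes "k \<le> l" "x \<in> frac_ideal a l"
  shows "x \<in> frac_ideal a k"
proof -
  have "t powi (- k) * x = t powi (l - k) * (t powi (- l) * x)"
    by (simp only: mult.assoc[symmetric] t_powi_add[symmetric]) simp
  moreover have "t powi (l - k) \<in> R"
    using assms(1) by (simp add: power_int_def R_power)
  ultimately show ?thesis
    using assms(2) by (simp only: frac_ideal_iff R_mult)
qed

text \<open>
  The local ring is local: \<open>frac_ideal a 1\<close> is its maximal ideal.
\<close>

lemma R_inverse:
  assumes "x \<in> R" "x \<notin> frac_ideal a 1"
  shows "inverse x \<in> R"
proof -
  obtain p q where x: "x = to_mfrac p / to_mfrac q" and q: "\<not> linear_poly a dvd q" "q \<noteq> 0"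
    using assms(1) by (rule R_E)
  have "\<not> linear_poly a dvd p"
  proof
    assume "linear_poly a dvd p"
    then obtain s where "p = linear_poly a * s" ..
    then have "x = t powi 1 * (to_mfrac s / to_mfrac q)"
      by (simp add: x to_mfrac_mult)
    then show False
      using assms(2) R_I[OF q(1)] unfolding frac_ideal_def by blast
  qed
  then show ?thesis
    using R_I[of p q] by (simp add: x)
qed

lemma to_mfrac_in_frac_ideal_iff: "to_mfrac p \<in> frac_ideal a 1 \<longleftrightarrow> linear_poly a dvd p"
proof
  assume "linear_poly a dvd p"
  then obtain s where "p = linear_poly a * s" ..
  then show "to_mfrac p \<in> frac_ideal a 1"
    using frac_ideal_mult_R[OF R_to_mfrac t_in, of s] by (simp add: to_mfrac_mult mult.commute)
next
  assume "to_mfrac p \<in> frac_ideal a 1"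
  then obtain u where "u \<in> R" "to_mfrac p = t * u"
    by (auto simp: frac_ideal_def)
  then obtain s q where "to_mfrac p = t * (to_mfrac s / to_mfrac q)" and q: "\<not> linear_poly a dvd q" "q \<noteq> 0"
    by (auto elim: R_E)
  then have "to_mfrac (p * q) = to_mfrac (linear_poly a * s)"
    by (simp add: to_mfrac_mult field_simps)
  then have "p * q = linear_poly a * s"
    by (simp only: to_mfrac_eq_iff)
  then show "linear_poly a dvd p"
    using q dvd_mult_iff[of p q] by simp
qed

lemma frac_ideal_prime:
  assumes "x * y \<in> frac_ideal a 1" "x \<in> R" "x \<notin> frac_ideal a 1"
  shows "y \<in> frac_ideal a 1"
proof -
  have "x \<noteq> 0" using assms(3) by auto
  then have "y = inverse x * (x * y)" by simp
  then show ?thesis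
    using frac_ideal_mult_R[OF R_inverse[OF assms(2,3)] assms(1)] by argo
qed

lemma R_inverse_to_mfrac: "\<not> linear_poly a dvd p \<Longrightarrow> inverse (to_mfrac p) \<in> R"
  by (rule R_inverse) (auto simp: to_mfrac_in_frac_ideal_iff)

lemma cst_not_in: "c \<noteq> 0 \<Longrightarrow> cst c \<notin> frac_ideal a 1"
  by (simp add: to_mfrac_in_frac_ideal_iff linear_poly_dvd_iff homothety_def)

lemma R_der_apply:
  assumes "x \<in> R" "\<And>i. \<theta> $ i \<in> R"
  shows "der_apply \<theta> x \<in> R"
proof -
  obtain p q where x: "x = to_mfrac p / to_mfrac q" and q: "\<not> linear_poly a dvd q" "q \<noteq> 0"
    using assms(1) by (rule R_E)
  have "mfrac_pderiv i x = to_mfrac (mpoly_pderiv i p * q - p * mpoly_pderiv i q) / to_mfrac (q * q)" for i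
    unfolding x mfrac_pderiv_quotient[OF q(2)] to_mfrac_diff to_mfrac_mult ..
  then have "mfrac_pderiv i x \<in> R" for i
    using q(1) by (simp only: R_I dvd_mult_iff simp_thms)
  then show ?thesis
    unfolding der_apply_def by (intro R_sum R_mult assms)
qed

text \<open>
  Such a derivation kills every power of \<open>t\<close> and so commutes with multiplication by it.
\<close>

lemma tangential_frac_ideal:
  assumes "x \<in> frac_ideal a k" "\<And>i. \<theta> $ i \<in> R" "der_apply \<theta> t = 0"
  shows "der_apply \<theta> x \<in> frac_ideal a k"
proof -
  obtain u where u: "u \<in> R" "x = t powi k * u"
    using assms(1) by (auto simp: frac_ideal_def)
  have "der_apply \<theta> (t powi k) * t = 0"
    using assms(3) by (simp add: der_apply_powi)
  then have "der_apply \<theta> x = t powi k * der_apply \<theta> u"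
    by (simp add: u(2) der_apply_mult)
  then show ?thesis
    using R_der_apply[OF u(1) assms(2)] by (auto simp: frac_ideal_def)
qed

end

section \<open>Reflections acting on the fraction field\<close>

lemma act_mpoly_add: "act_mpoly w (p + q) = act_mpoly w p + act_mpoly w q"
  by (simp add: act_mpoly_def mpoly_subst_add)

lemma act_mfrac_quotient:
  assumes "invertible w" "q \<noteq> 0"
  shows "act_mfrac w (to_mfrac p / to_mfrac q) = to_mfrac (act_mpoly w p) / to_mfrac (act_mpoly w q)"
  unfolding Fract_to_mfrac[symmetric] using assms by (rule act_mfrac_Fract)

lemma act_mfrac_to_mfrac:
  assumes "invertible w"
  shows "act_mfrac w (to_mfrac p) = to_mfrac (act_mpoly w p)"
  using act_mfrac_quotient[OF assms, of 1 p] by (simp add: act_mpoly_def)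

lemma act_mfrac_cst: "invertible w \<Longrightarrow> act_mfrac w (cst c) = cst c"
  by (simp add: act_mfrac_to_mfrac act_mpoly_def)

lemma act_mfrac_add:
  assumes w: "invertible w"
  shows "act_mfrac w (f + g) = act_mfrac w f + act_mfrac w g"
proof -
  obtain a b where b: "b \<noteq> 0" and f: "f = to_mfrac a / to_mfrac b" by (rule mfrac_cases)
  obtain c d where d: "d \<noteq> 0" and g: "g = to_mfrac c / to_mfrac d" by (rule mfrac_cases)
  have nz: "to_mfrac b \<noteq> 0" "to_mfrac d \<noteq> 0" "b * d \<noteq> 0"
    using b d by simp_all
  have nz': "to_mfrac (act_mpoly w b) \<noteq> 0" "to_mfrac (act_mpoly w d) \<noteq> 0"
    using b d w by (simp_all add: act_mpoly_eq_0_iff)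
  have eq: "f + g = to_mfrac (a * d + c * b) / to_mfrac (b * d)"
    unfolding f g to_mfrac_add to_mfrac_mult by (rule add_frac_eq[OF nz(1,2)])
  show ?thesis
    unfolding eq act_mfrac_quotient[OF w nz(3)]
    unfolding f g act_mfrac_quotient[OF w b] act_mfrac_quotient[OF w d]
      act_mpoly_add act_mpoly_mult to_mfrac_add to_mfrac_mult
    by (rule add_frac_eq[OF nz', symmetric])
qed

lemma act_mfrac_mult:
  assumes w: "invertible w"
  shows "act_mfrac w (f * g) = act_mfrac w f * act_mfrac w g"
proof -
  obtain a b where b: "b \<noteq> 0" and f: "f = to_mfrac a / to_mfrac b" by (rule mfrac_cases)
  obtain c d where d: "d \<noteq> 0" and g: "g = to_mfrac c / to_mfrac d" by (rule mfrac_cases)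
  have bd: "b * d \<noteq> 0"
    using b d by simp
  have eq: "f * g = to_mfrac (a * c) / to_mfrac (b * d)"
    unfolding f g to_mfrac_mult by (rule times_divide_times_eq)
  show ?thesis
    unfolding eq act_mfrac_quotient[OF w bd]
    unfolding f g act_mfrac_quotient[OF w b] act_mfrac_quotient[OF w d]
      act_mpoly_mult to_mfrac_mult
    by (rule times_divide_times_eq[symmetric])
qed

lemma act_mfrac_power:
  "invertible w \<Longrightarrow> act_mfrac w (f ^ k) = act_mfrac w f ^ k"
  using act_mfrac_cst[of w 1] by (induction k) (simp_all add: act_mfrac_mult)

context hyperplane
begin

text \<open>
  The inverse appears because a matrix acts on functions through its inverse.
\<close>

definition acts_as_homothety :: "'n cmat \<Rightarrow> complex \<Rightarrow> bool" where
  "acts_as_homothety w c \<longleftrightarrow> invertible w \<and>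
     (\<forall>v. matrix_inv w *v v = v + ((c - 1) * linear_form a v) *s r)"

lemma act_mpoly_homothety:
  assumes "acts_as_homothety w c"
  shows "act_mpoly w p = homothety c p"
proof -
  have entry: "matrix_inv w $ i $ j = mat 1 $ i $ j + (c - 1) * r $ i * a $ j" for i j
  proof -
    have "linear_form a (axis j 1) = a $ j"
      by (simp add: linear_form_def axis_def if_distrib cong: if_cong)
    moreover have "(matrix_inv w *v axis j 1) $ i = matrix_inv w $ i $ j"
      by (simp add: matrix_vector_mult_def axis_def if_distrib cong: if_cong)
    moreover have "matrix_inv w *v axis j 1 =
        axis j 1 + ((c - 1) * linear_form a (axis j 1)) *s r"
      using assms by (simp only: acts_as_homothety_def)
    ultimately have "matrix_inv w $ i $ j = axis j 1 $ i + (c - 1) * a $ j * r $ i"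
      by (simp only: vector_add_component vector_smult_component)
    then show ?thesis
      by (simp add: axis_def mat_def mult_ac)
  qed
  have "matrix_inv w $ i = mat 1 $ i + ((c - 1) * r $ i) *s a" for i
    by (simp add: vec_eq_iff entry)
  then have "linear_poly (matrix_inv w $ i) =
      mpoly_var i + mpoly_const ((c - 1) * r $ i) * linear_poly a" for i
    by (simp only: linear_poly_add_smult linear_poly_axis)
  then show ?thesis
    by (simp add: act_mpoly_def homothety_def)
qed

lemma act_t:
  assumes "acts_as_homothety w c"
  shows "act_mfrac w t = cst c * t"
  using assms act_mfrac_to_mfrac[of w "linear_poly a"]
  by (simp add: act_mpoly_homothety homothety_normal to_mfrac_mult) (simp add: acts_as_homothety_def)

lemma ratio_nonzero:
  assumes "acts_as_homothety w c"
  shows "c \<noteq> 0"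
proof
  assume "c = 0"
  then have "act_mpoly w (linear_poly a) = 0"
    using assms by (simp add: act_mpoly_homothety homothety_normal)
  then show False
    using assms by (simp add: act_mpoly_eq_0_iff acts_as_homothety_def)
qed

text \<open>
  A homothety fixes the hyperplane pointwise, so it acts trivially on the residue field.
\<close>

lemma act_cong:
  assumes w: "acts_as_homothety w c" and "x \<in> R"
  shows "act_mfrac w x - x \<in> frac_ideal a 1"
proof -
  obtain p q where x: "x = to_mfrac p / to_mfrac q" and q: "\<not> linear_poly a dvd q" "q \<noteq> 0"
    using assms(2) by (rule R_E)
  have inv: "invertible w"
    using w by (simp add: acts_as_homothety_def)
  define p' q' where "p' = homothety c p" and "q' = homothety c q"
  have dvd: "linear_poly a dvd p' - p" "linear_poly a dvd q' - q"
    by (simp_all add: p'_def q'_def homothety_cong)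
  have "\<not> linear_poly a dvd q'"
    using q(1) dvd(2) dvd_diff[of "linear_poly a" q' "q' - q"] by auto
  then have nd: "\<not> linear_poly a dvd q' * q" and "q' \<noteq> 0"
    using q(1) by (auto simp: dvd_mult_iff)
  have "p' * q - p * q' = (p' - p) * q - p * (q' - q)"
    by (simp add: algebra_simps)
  then have "linear_poly a dvd p' * q - p * q'"
    using dvd by (metis dvd_diff dvd_mult dvd_mult2)
  then have "to_mfrac (p' * q - p * q') \<in> frac_ideal a 1"
    by (simp add: to_mfrac_in_frac_ideal_iff)
  then have "inverse (to_mfrac (q' * q)) * to_mfrac (p' * q - p * q') \<in> frac_ideal a 1"
    using R_inverse_to_mfrac[OF nd] by (intro frac_ideal_mult_R)
  moreover have "act_mfrac w x - x = inverse (to_mfrac (q' * q)) * to_mfrac (p' * q - p * q')"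
  proof -
    have "act_mfrac w x - x = to_mfrac p' / to_mfrac q' - to_mfrac p / to_mfrac q"
      unfolding x act_mfrac_quotient[OF inv q(2)] act_mpoly_homothety[OF w] p'_def q'_def ..
    also have "\<dots> = (to_mfrac p' * to_mfrac q - to_mfrac p * to_mfrac q') / (to_mfrac q' * to_mfrac q)"
      using \<open>q' \<noteq> 0\<close> q(2) by (intro diff_frac_eq) simp_all
    finally show ?thesis
      by (simp only: to_mfrac_diff to_mfrac_mult divide_inverse mult.commute)
  qed
  ultimately show ?thesis
    by simp
qed

text \<open>
  Differentiation in the direction of \<open>r\<close>.
\<close>

definition normal_der :: "'n der" where
  "normal_der = (\<chi> i. cst (r $ i))"

lemma normal_der_lin: "der_apply normal_der (lin b) = cst (linear_form b r)"
  by (simp add: der_apply_lin normal_der_def linear_form_def mpoly_const_sum mpoly_const_mult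
      to_mfrac_sum to_mfrac_mult)

lemma normal_der_t [simp]: "der_apply normal_der t = 1"
  by (simp add: normal_der_lin normalized)

lemma normal_der_R [simp]: "normal_der $ i \<in> R"
  by (simp add: normal_der_def)

text \<open>
  The chain rule: differentiating \<open>f\<close> composed with a map that multiplies \<open>r\<close> by \<open>c\<close> produces
  a factor \<open>c\<close>. Both sides are derivations twisted by the action, so it is enough to compare
  them on coordinates.
\<close>

lemma normal_der_act:
  assumes w: "acts_as_homothety w c"
  shows "der_apply normal_der (act_mfrac w f) = cst c * act_mfrac w (der_apply normal_der f)"
proof -
  have inv: "invertible w"
    using w by (simp add: acts_as_homothety_def)
  note act = act_mfrac_add[OF inv] act_mfrac_mult[OF inv] act_mfrac_cst[OF inv]
  have act0: "act_mfrac w 0 = 0"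
    using act_mfrac_cst[OF inv, of 0] by simp
  have poly: "der_apply normal_der (act_mfrac w (to_mfrac p)) =
      cst c * act_mfrac w (der_apply normal_der (to_mfrac p))" for p
  proof (induction p rule: mpoly_induct)
    case (const d)
    then show ?case by (simp add: act act0)
  next
    case (var i)
    have "act_mfrac w (to_mfrac (mpoly_var i)) =
        to_mfrac (mpoly_var i) + cst ((c - 1) * r $ i) * t"
      by (simp add: act_mfrac_to_mfrac[OF inv] act_mpoly_homothety[OF w] homothety_def
          to_mfrac_add to_mfrac_mult)
    then have "der_apply normal_der (act_mfrac w (to_mfrac (mpoly_var i))) =
        cst (r $ i) + cst ((c - 1) * r $ i)"
      by (simp add: der_apply_add der_apply_mult der_apply_var) (simp add: normal_der_def)
    also have "\<dots> = cst (c * r $ i)"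
      by (simp only: to_mfrac_add[symmetric] mpoly_const_add[symmetric]) (simp add: algebra_simps)
    finally show ?case
      by (simp add: der_apply_var normal_der_def act mpoly_const_mult to_mfrac_mult)
  next
    case (add p q)
    then show ?case
      by (simp only: to_mfrac_add der_apply_add act distrib_left)
  next
    case (mult p q)
    show ?case
      unfolding to_mfrac_mult der_apply_mult act mult
      by (simp only: distrib_left mult_ac)
  qed
  obtain p q where q: "q \<noteq> 0" and f: "f = to_mfrac p / to_mfrac q" by (rule mfrac_cases)
  \<comment> \<open>Twisted derivations that agree on \<open>f Q\<close> and on \<open>Q\<close> agree on \<open>f\<close>.\<close>
  define Q where "Q = to_mfrac q"
  have fQ: "f * Q = to_mfrac p" and nz: "act_mfrac w Q \<noteq> 0"
    using q inv by (simp_all add: f Q_def act_mfrac_to_mfrac act_mpoly_eq_0_iff)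
  have "der_apply normal_der (act_mfrac w (f * Q)) =
      cst c * act_mfrac w (der_apply normal_der (f * Q))"
    unfolding fQ by (rule poly)
  then have "der_apply normal_der (act_mfrac w f) * act_mfrac w Q +
      act_mfrac w f * (cst c * act_mfrac w (der_apply normal_der Q)) =
      cst c * (act_mfrac w (der_apply normal_der f) * act_mfrac w Q +
        act_mfrac w f * act_mfrac w (der_apply normal_der Q))"
    unfolding act der_apply_mult using poly[of q, folded Q_def] by simp
  then have "der_apply normal_der (act_mfrac w f) * act_mfrac w Q =
      (cst c * act_mfrac w (der_apply normal_der f)) * act_mfrac w Q"
    by (simp add: algebra_simps)
  then show ?thesis
    using nz by simp
qed

text \<open>
  The semi-invariants in question are those for which \<open>t g\<close> is invariant. If \<open>g = t^k h\<close>, then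
  \<open>h\<close> is multiplied by the powers of exponent \<open>k + 1\<close> of the ratios. As long as \<open>k + 1\<close> is
  smaller than the number of elements of \<open>G\<close>, some ratio is not a root of unity of that
  exponent; as \<open>G\<close> acts trivially on the residue field, \<open>h\<close> must vanish there, and \<open>k\<close> can be
  raised.
\<close>

lemma semi_invariant_frac_ideal:
  assumes G: "finite G" "card G > 0" "inj_on \<kappa> G"
    and hom: "\<And>w. w \<in> G \<Longrightarrow> acts_as_homothety w (\<kappa> w)"
    and "g \<in> R" and semi: "\<And>w. w \<in> G \<Longrightarrow> g = cst (\<kappa> w) * act_mfrac w g"
  shows "g \<in> frac_ideal a (int (card G) - 1)"
proof -
  have "k < card G \<Longrightarrow> g \<in> frac_ideal a (int k)" for k
  proof (induction k)
    case 0
    then show ?case using \<open>g \<in> R\<close> by simp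
  next
    case (Suc k)
    then obtain h where h: "h \<in> R" "g = t ^ k * h"
      by (auto simp: frac_ideal_def)
    obtain w where w: "w \<in> G" "\<kappa> w ^ Suc k \<noteq> 1"
    proof (rule ccontr)
      assume "\<not> thesis"
      then have "\<kappa> ` G \<subseteq> {z. z ^ Suc k = 1}"
        using that by blast
      then have "card (\<kappa> ` G) \<le> card {z::complex. z ^ Suc k = 1}"
        by (intro card_mono finite_nth_roots) simp_all
      then show False
        using Suc.prems G(3) card_nth_roots[of 1 "Suc k"] by (simp add: card_image)
    qed
    note hw = hom[OF w(1)]
    have inv: "invertible w"
      using hw by (simp add: acts_as_homothety_def)
    define C where "C = \<kappa> w ^ Suc k"
    have "t ^ k * h = cst (\<kappa> w) * ((cst (\<kappa> w) * t) ^ k * act_mfrac w h)"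
      using semi[OF w(1)] by (simp only: h(2) act_mfrac_mult[OF inv] act_mfrac_power[OF inv] act_t[OF hw])
    also have "\<dots> = t ^ k * (cst C * act_mfrac w h)"
      by (simp add: C_def mpoly_const_mult mpoly_const_power to_mfrac_mult to_mfrac_power
          power_mult_distrib mult_ac)
    finally have "h = cst C * act_mfrac w h"
      by simp
    then have "cst (1 - C) * h = cst C * (act_mfrac w h - h)"
      by (simp add: mpoly_const_diff to_mfrac_diff algebra_simps)
    then have "cst (1 - C) * h \<in> frac_ideal a 1"
      using frac_ideal_mult_R[OF R_to_mfrac act_cong[OF hw h(1)]] by simp
    moreover have "1 - C \<noteq> 0"
      using w(2) by (simp add: C_def)
    ultimately have "h \<in> frac_ideal a 1"
      by (rule frac_ideal_prime[OF _ R_to_mfrac cst_not_in])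
    then show ?case
      using t_powi_mult_in_iff[of "int k" h 1] h(2) by (simp add: add.commute)
  qed
  from this[of "card G - 1"] show ?thesis
    using G(2) by (simp add: of_nat_diff)
qed

end

section \<open>Comparison at one hyperplane\<close>

text \<open>
  The condition at one hyperplane that membership in \<open>D_mult\<close> imposes. Orthogonality to the
  linear form of the hyperplane is expressed by the vanishing at \<open>r\<close>.
\<close>

definition local_der :: "'n cvec \<Rightarrow> 'n cvec \<Rightarrow> int \<Rightarrow> (('n::{finite,linorder}) der) set" where
  "local_der a r m = {\<eta>. der_apply \<eta> (lin a) \<in> frac_ideal a m \<and>
     (\<forall>b. linear_form b r = 0 \<longrightarrow> der_apply \<eta> (lin b) \<in> local_ring a)}"

context hyperplane
begin

definition tangential :: "'n der \<Rightarrow> 'n der" where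
  "tangential \<eta> = \<eta> - der_apply \<eta> t *s normal_der"

lemma tangential_t [simp]: "der_apply (tangential \<eta>) t = 0"
  by (simp add: tangential_def der_apply_der_diff der_apply_der_smult)

lemma tangential_decomp: "\<eta> = der_apply \<eta> t *s normal_der + tangential \<eta>"
  by (simp add: tangential_def vec_eq_iff)

lemma der_apply_decomp:
  "der_apply \<eta> f = der_apply \<eta> t * der_apply normal_der f + der_apply (tangential \<eta>) f"
  by (subst (1) tangential_decomp[of \<eta>]) (simp only: der_apply_der_add der_apply_der_smult)

text \<open>
  The coefficients of the tangential part are values of \<open>\<eta>\<close> at linear forms that vanish at \<open>r\<close>,
  namely the coordinates corrected by multiples of \<open>t\<close>. This is how the condition on all such
  linear forms turns into integrality of finitely many coefficients.
\<close>

lemma tangential_nth: "tangential \<eta> $ i = der_apply \<eta> (lin (axis i 1 - r $ i *s a))"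
proof -
  have "der_apply \<eta> (lin (axis i 1)) = \<eta> $ i"
    by (simp add: der_apply_lin axis_def if_distrib[of mpoly_const] if_distrib[of to_mfrac]
        if_distrib[of "\<lambda>x. x * _"] cong: if_cong)
  then show ?thesis
    by (simp add: linear_poly_diff_smult to_mfrac_diff to_mfrac_mult der_apply_diff der_apply_mult
        tangential_def normal_der_def mult.commute)
qed

lemma local_der_iff:
  "\<eta> \<in> local_der a r m \<longleftrightarrow> der_apply \<eta> t \<in> frac_ideal a m \<and> (\<forall>i. tangential \<eta> $ i \<in> R)"
proof (intro iffI conjI allI)
  fix i
  assume "\<eta> \<in> local_der a r m"
  moreover have "linear_form (axis i 1 - r $ i *s a) r = 0"
    by (simp add: linear_form_diff_smult normalized)
  ultimately show "tangential \<eta> $ i \<in> R"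
    by (simp add: tangential_nth local_der_def)
next
  assume *: "der_apply \<eta> t \<in> frac_ideal a m \<and> (\<forall>i. tangential \<eta> $ i \<in> R)"
  have "der_apply \<eta> (lin b) \<in> R" if "linear_form b r = 0" for b
    using * that
    by (subst der_apply_decomp) (simp add: normal_der_lin R_der_apply)
  then show "\<eta> \<in> local_der a r m"
    using * by (simp add: local_der_def)
qed (simp add: local_der_def)

lemma local_der_add: "\<eta> \<in> local_der a r m \<Longrightarrow> \<eta>' \<in> local_der a r m \<Longrightarrow> \<eta> + \<eta>' \<in> local_der a r m"
  by (simp add: local_der_def der_apply_der_add frac_ideal_add R_add)

lemma local_der_scale: "u \<in> R \<Longrightarrow> \<eta> \<in> local_der a r m \<Longrightarrow> u *s \<eta> \<in> local_der a r m"
  by (simp add: local_der_def der_apply_der_smult frac_ideal_mult_R R_mult)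

lemma local_der_0_iff: "\<eta> \<in> local_der a r 0 \<longleftrightarrow> (\<forall>i. \<eta> $ i \<in> R)"
proof
  assume *: "\<eta> \<in> local_der a r 0"
  have "(der_apply \<eta> t *s normal_der + tangential \<eta>) $ i \<in> R" for i
    using * by (simp add: local_der_iff R_add R_mult)
  then show "\<forall>i. \<eta> $ i \<in> R"
    by (simp add: tangential_decomp[symmetric])
next
  assume "\<forall>i. \<eta> $ i \<in> R"
  then show "\<eta> \<in> local_der a r 0"
    by (simp add: local_der_def R_der_apply)
qed

lemma local_der_normal: "x \<in> frac_ideal a m \<Longrightarrow> x *s normal_der \<in> local_der a r m"
  by (simp add: local_der_def der_apply_der_smult normal_der_lin normalized)

end

text \<open>
  What invariance and universality of \<open>\<zeta>\<close> say at one hyperplane: \<open>G\<close> is the pointwise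
  stabilizer of the hyperplane, \<open>\<kappa> w\<close> is the factor by which \<open>w\<close> multiplies \<open>t\<close>, and \<open>n\<close> is the
  multiplicity for which \<open>\<zeta>\<close> is universal.
\<close>

locale local_universal = hyperplane a r
  for a r :: "('n::{finite,linorder}) cvec" +
  fixes \<zeta> :: "'n der" and n :: int and G :: "'n cmat set" and \<kappa> :: "'n cmat \<Rightarrow> complex"
  assumes finite_G: "finite G" and card_G: "card G \<ge> 2" and inj_\<kappa>: "inj_on \<kappa> G"
    and G_homothety: "w \<in> G \<Longrightarrow> acts_as_homothety w (\<kappa> w)"
    and \<zeta>_normal: "w \<in> G \<Longrightarrow> act_mfrac w (der_apply \<zeta> t) = cst (\<kappa> w) * der_apply \<zeta> t"
    and \<zeta>_tangential: "w \<in> G \<Longrightarrow> linear_form b r = 0 \<Longrightarrow>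
      act_mfrac w (der_apply \<zeta> (lin b)) = der_apply \<zeta> (lin b)"
    and \<zeta>_regular: "linear_form b r = 0 \<Longrightarrow> der_apply \<zeta> (lin b) \<in> R"
    and \<zeta>_pole: "\<exists>N. der_apply \<zeta> t \<in> frac_ideal a (- int N)"
    and \<Phi>_mem: "\<theta> \<in> local_der a r 0 \<Longrightarrow> nabla \<theta> \<zeta> \<in> local_der a r n"
    and \<Phi>_surj: "\<eta> \<in> local_der a r n \<Longrightarrow> \<exists>\<theta>\<in>local_der a r 0. nabla \<theta> \<zeta> = \<eta>"
    and \<Phi>_inj: "nabla \<theta> \<zeta> = 0 \<Longrightarrow> \<theta> = 0"
begin

abbreviation "z \<equiv> der_apply \<zeta> t"
abbreviation "\<delta> \<equiv> der_apply normal_der"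

text \<open>
  This bounds how large a pole of \<open>\<theta>(t)\<close> the tangential components of \<open>nabla \<theta> \<zeta>\<close> can
  tolerate.
\<close>

lemma normal_derivative_tangential:
  assumes "linear_form b r = 0"
  shows "\<delta> (der_apply \<zeta> (lin b)) \<in> frac_ideal a (int (card G) - 1)"
proof (rule semi_invariant_frac_ideal[OF finite_G _ inj_\<kappa> G_homothety])
  show "\<delta> (der_apply \<zeta> (lin b)) \<in> R"
    by (intro R_der_apply \<zeta>_regular assms) simp
  show "\<delta> (der_apply \<zeta> (lin b)) = cst (\<kappa> w) * act_mfrac w (\<delta> (der_apply \<zeta> (lin b)))" if "w \<in> G" for w
    using normal_der_act[OF G_homothety[OF that], of "der_apply \<zeta> (lin b)"]
    by (simp add: \<zeta>_tangential[OF that assms])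
qed (use card_G in auto)

lemma \<delta>z_mem: "\<delta> z \<in> frac_ideal a n"
  using \<Phi>_mem[of normal_der] by (simp add: local_der_0_iff) (simp add: local_der_def nabla_lin)

text \<open>
  Start from any bound on the pole of \<open>z\<close> and raise the order \<open>k\<close>. Write \<open>z = t^k h\<close> with
  \<open>k \<le> n\<close>. If \<open>k \<noteq> 0\<close>, the leading term of the normal derivative of \<open>z\<close> is \<open>k t^(k-1) h\<close>, and as
  this derivative has order at least \<open>n\<close>, \<open>h\<close> must vanish on the hyperplane. The derivative
  says nothing if \<open>k = 0\<close>; there it is used that \<open>z\<close> is multiplied by a nontrivial factor under
  some reflection, while its restriction to the hyperplane is fixed.
\<close>

lemma z_mem: "z \<in> frac_ideal a (n + 1)"
proof -
  obtain N where N: "z \<in> frac_ideal a (- int N)"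
    using \<zeta>_pole by blast
  have step: "z \<in> frac_ideal a (k + 1)" if k: "k \<le> n" "z \<in> frac_ideal a k" for k
  proof -
    obtain h where h: "h \<in> R" "z = t powi k * h"
      using k(2) by (auto simp: frac_ideal_def)
    have "h \<in> frac_ideal a 1"
    proof (cases "k = 0")
      case True
      have "\<exists>w\<in>G. \<kappa> w \<noteq> 1"
      proof (rule ccontr)
        assume "\<not> (\<exists>w\<in>G. \<kappa> w \<noteq> 1)"
        then have "\<kappa> ` G \<subseteq> {1}" by auto
        then have "card (\<kappa> ` G) \<le> 1"
          using card_mono[of "{1}" "\<kappa> ` G"] by simp
        then show False
          using card_G card_image[OF inj_\<kappa>] by simp
      qed
      then obtain w where w: "w \<in> G" "\<kappa> w \<noteq> 1" ..
      have "z \<in> R"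
        using k(2) True by simp
      then have "act_mfrac w z - z \<in> frac_ideal a 1"
        by (rule act_cong[OF G_homothety[OF w(1)]])
      also have "act_mfrac w z - z = cst (\<kappa> w - 1) * z"
        by (simp add: \<zeta>_normal[OF w(1)] mpoly_const_diff to_mfrac_diff algebra_simps)
      finally have "cst (\<kappa> w - 1) * z \<in> frac_ideal a 1" .
      moreover have "\<kappa> w - 1 \<noteq> 0"
        using w(2) by simp
      ultimately have "z \<in> frac_ideal a 1"
        by (rule frac_ideal_prime[OF _ R_to_mfrac cst_not_in])
      then show ?thesis
        using h(2) True by simp
    next
      case False
      \<comment> \<open>The Leibniz rule is multiplied by \<open>t\<close> so that no exponent \<open>k - 1\<close> occurs.\<close>
      have "\<delta> z * t = \<delta> (t powi k) * t * h + t powi k * \<delta> h * t"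
        by (simp add: h(2) der_apply_mult algebra_simps)
      also have "\<delta> (t powi k) * t = of_int k * t powi k"
        by (subst der_apply_powi) simp_all
      finally have "t powi k * (of_int k * h) = \<delta> z * t - t powi k * \<delta> h * t"
        by (simp add: algebra_simps)
      moreover have "\<delta> z * t \<in> frac_ideal a (k + 1)"
        using k(1) \<delta>z_mem by (intro frac_ideal_mult t_in) (rule frac_ideal_mono)
      moreover have "t powi k * \<delta> h * t \<in> frac_ideal a (k + 1)"
      proof (intro frac_ideal_mult t_in)
        show "t powi k * \<delta> h \<in> frac_ideal a k"
          using frac_ideal_mult[of "t powi k" k "\<delta> h" 0] R_der_apply[OF h(1)] by simp
      qed
      ultimately have "of_int k * h \<in> frac_ideal a 1"
        by (simp only: frac_ideal_diff t_powi_mult_in_iff[symmetric, of "of_int k * h" 1 k])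
      moreover have "of_int k = (cst (of_int k) :: 'n mfrac)"
      proof -
        have nat: "of_nat m = (cst (of_nat m) :: 'n mfrac)" for m
          by (induction m) (simp_all add: mpoly_const_add to_mfrac_add)
        show ?thesis
          by (cases k rule: int_cases2) (simp_all add: nat mpoly_const_minus to_mfrac_minus)
      qed
      ultimately have "cst (of_int k) * h \<in> frac_ideal a 1"
        by (simp only:)
      moreover have "(of_int k :: complex) \<noteq> 0"
        using False by simp
      ultimately show ?thesis
        by (rule frac_ideal_prime[OF _ R_to_mfrac cst_not_in])
    qed
    then show ?thesis
      by (simp only: h(2) t_powi_mult_in_iff)
  qed
  have "- int N \<le> k \<Longrightarrow> k \<le> n + 1 \<longrightarrow> z \<in> frac_ideal a k" for k
    by (induction k rule: int_ge_induct) (use N step in auto)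
  from this[of "n + 1"] show ?thesis
    using frac_ideal_mono[OF _ N, of "n + 1"] by linarith
qed

lemma tangential_z:
  assumes "\<theta> \<in> local_der a r m"
  shows "der_apply (tangential \<theta>) z \<in> frac_ideal a (n + 1)"
  using assms by (intro tangential_frac_ideal[OF z_mem]) (simp_all add: local_der_iff)

text \<open>
  Some derivation regular along the hyperplane is mapped to \<open>t^n\<close> times the normal derivation.
  Its tangential part contributes order at least \<open>n + 1\<close> to the normal component, so the
  multiple of \<open>\<delta> z\<close> has to supply the order exactly \<open>n\<close>.
\<close>

lemma \<delta>z_not_mem: "\<delta> z \<notin> frac_ideal a (n + 1)"
proof
  assume *: "\<delta> z \<in> frac_ideal a (n + 1)"
  obtain \<theta> where \<theta>: "\<theta> \<in> local_der a r 0" "nabla \<theta> \<zeta> = t powi n *s normal_der"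
    using \<Phi>_surj local_der_normal[OF t_powi_in] by blast
  have "t powi n = der_apply (nabla \<theta> \<zeta>) t"
    by (simp add: \<theta>(2) der_apply_der_smult)
  also have "\<dots> = der_apply \<theta> t * \<delta> z + der_apply (tangential \<theta>) z"
    unfolding nabla_lin by (rule der_apply_decomp)
  also have "\<dots> \<in> frac_ideal a (n + 1)"
    using \<theta>(1) * by (intro frac_ideal_add frac_ideal_mult_R tangential_z[OF \<theta>(1)]) (simp_all add: local_der_def)
  finally have "t powi n * 1 \<in> frac_ideal a (n + 1)"
    by simp
  then have "1 \<in> frac_ideal a 1"
    by (simp only: t_powi_mult_in_iff)
  then show False
    using cst_not_in[of 1] by simp
qed

text \<open>
  The normal derivative of \<open>z\<close> is \<open>t^n\<close> times a unit of the local ring.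
\<close>

lemma divide_\<delta>z:
  assumes "x \<in> frac_ideal a (n + m)"
  shows "x / \<delta> z \<in> frac_ideal a m"
proof -
  define U where "U = t powi (- n) * \<delta> z"
  have dz: "\<delta> z = t powi n * U"
    by (simp only: U_def mult.assoc[symmetric] t_powi_cancel mult_1_left)
  have "U \<in> R"
    using \<delta>z_mem by (simp add: U_def frac_ideal_iff)
  moreover have "U \<notin> frac_ideal a 1"
    using \<delta>z_not_mem by (simp only: dz t_powi_mult_in_iff not_False_eq_True)
  ultimately have U: "inverse U \<in> R"
    by (rule R_inverse)
  have "t powi (- n) * x \<in> frac_ideal a (- n + (n + m))"
    using assms by (intro frac_ideal_mult t_powi_in)
  then have "inverse U * (t powi (- n) * x) \<in> frac_ideal a m"
    using frac_ideal_mult_R[OF U] by simp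
  also have "inverse U * (t powi (- n) * x) = x / \<delta> z"
    by (simp only: dz divide_inverse inverse_mult_distrib power_int_minus mult_ac)
  finally show ?thesis .
qed

text \<open>
  The lower bound on \<open>m\<close> keeps the tangential components regular, the upper bound lets the
  tangential part of \<open>\<theta>\<close> contribute to the normal component without spoiling its order.
\<close>

lemma nabla_local_der:
  assumes m: "1 - int (card G) \<le> m" "m \<le> 1" and \<theta>: "\<theta> \<in> local_der a r m"
  shows "nabla \<theta> \<zeta> \<in> local_der a r (n + m)"
proof -
  have "der_apply \<theta> z \<in> frac_ideal a (n + m)"
  proof (subst der_apply_decomp, rule frac_ideal_add)
    show "der_apply \<theta> t * \<delta> z \<in> frac_ideal a (n + m)"
      using frac_ideal_mult[OF _ \<delta>z_mem, of _ m] \<theta> by (simp add: local_der_def add.commute)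
    show "der_apply (tangential \<theta>) z \<in> frac_ideal a (n + m)"
      using m(2) by (intro frac_ideal_mono[OF _ tangential_z[OF \<theta>]]) simp
  qed
  moreover have "der_apply \<theta> (der_apply \<zeta> (lin b)) \<in> R" if b: "linear_form b r = 0" for b
  proof (subst der_apply_decomp, rule R_add)
    have "der_apply \<theta> t * \<delta> (der_apply \<zeta> (lin b)) \<in> frac_ideal a (m + (int (card G) - 1))"
      using \<theta> normal_derivative_tangential[OF b] by (intro frac_ideal_mult) (simp_all add: local_der_def)
    then show "der_apply \<theta> t * \<delta> (der_apply \<zeta> (lin b)) \<in> R"
      using m(1) frac_ideal_mono[of 0 "m + (int (card G) - 1)"] by simp
    show "der_apply (tangential \<theta>) (der_apply \<zeta> (lin b)) \<in> R"
      using \<theta> by (intro R_der_apply \<zeta>_regular b) (simp add: local_der_iff)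
  qed
  ultimately show ?thesis
    by (simp add: local_der_def nabla_lin)
qed

text \<open>
  For the converse, a multiple of the normal derivation is subtracted from \<open>\<theta>\<close> so that the
  normal component of the image vanishes. The image of the difference then satisfies the
  condition for every multiplicity, in particular for \<open>n\<close>, so the difference itself is regular
  by universality; its vanishing normal component even shows that it satisfies the condition
  for multiplicity \<open>1\<close>.
\<close>

lemma nabla_local_der_iff:
  assumes m: "1 - int (card G) \<le> m" "m \<le> 1"
  shows "nabla \<theta> \<zeta> \<in> local_der a r (n + m) \<longleftrightarrow> \<theta> \<in> local_der a r m"
proof
  assume *: "nabla \<theta> \<zeta> \<in> local_der a r (n + m)"
  define x where "x = der_apply \<theta> z / \<delta> z"
  define \<theta>' where "\<theta>' = \<theta> - x *s normal_der"
  have nz: "\<delta> z \<noteq> 0"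
    using \<delta>z_not_mem by auto
  have x: "x \<in> frac_ideal a m"
    using * unfolding x_def by (intro divide_\<delta>z) (simp add: local_der_def nabla_lin)
  then have xn: "x *s normal_der \<in> local_der a r m"
    by (rule local_der_normal)
  have "- 1 *s nabla (x *s normal_der) \<zeta> \<in> local_der a r (n + m)"
    using nabla_local_der[OF m xn] R_minus[OF R_1] by (rule local_der_scale[rotated])
  then have "nabla \<theta> \<zeta> + (- 1) *s nabla (x *s normal_der) \<zeta> \<in> local_der a r (n + m)"
    by (rule local_der_add[OF *])
  then have mem: "nabla \<theta>' \<zeta> \<in> local_der a r (n + m)"
    by (simp add: \<theta>'_def nabla_diff)
  have z0: "der_apply \<theta>' z = 0"
    using nz by (simp add: \<theta>'_def der_apply_der_diff der_apply_der_smult x_def)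
  then have "nabla \<theta>' \<zeta> \<in> local_der a r n"
    using mem by (simp add: local_der_def nabla_lin)
  then obtain \<theta>'' where "\<theta>'' \<in> local_der a r 0" "nabla \<theta>'' \<zeta> = nabla \<theta>' \<zeta>"
    using \<Phi>_surj by blast
  moreover from this have "\<theta>'' = \<theta>'"
    using \<Phi>_inj[of "\<theta>'' - \<theta>'"] by (simp add: nabla_diff)
  ultimately have \<theta>': "\<theta>' \<in> local_der a r 0"
    by simp
  have "der_apply \<theta>' t * \<delta> z = - der_apply (tangential \<theta>') z"
    using z0 by (subst (asm) der_apply_decomp) (simp add: eq_neg_iff_add_eq_0)
  then have eq: "der_apply \<theta>' t = - der_apply (tangential \<theta>') z / \<delta> z"
    using nz by (simp add: field_simps)
  have "- der_apply (tangential \<theta>') z \<in> frac_ideal a (n + 1)"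
    using frac_ideal_diff[OF frac_ideal_zero tangential_z[OF \<theta>']] by simp
  from divide_\<delta>z[OF this] have "der_apply \<theta>' t \<in> frac_ideal a 1"
    by (simp only: eq)
  then have "\<theta>' \<in> local_der a r m"
    using \<theta>' m(2) frac_ideal_mono[of m 1] by (simp add: local_der_iff)
  then have "x *s normal_der + \<theta>' \<in> local_der a r m"
    by (rule local_der_add[OF xn])
  then show "\<theta> \<in> local_der a r m"
    by (simp add: \<theta>'_def)
qed (rule nabla_local_der[OF m])

end

section \<open>Clearing denominators\<close>

text \<open>
  The multiplicative set \<open>P\<close> is instantiated with the nonzero polynomials, the polynomials not
  divisible by a given linear form, and the powers of the arrangement polynomial.
\<close>

lemma common_denominator:
  assumes "finite X"
    and frac: "\<And>x. x \<in> X \<Longrightarrow> \<exists>p q. x = to_mfrac p / to_mfrac q \<and> P q"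
    and one: "P 1" and mult: "\<And>q q'. P q \<Longrightarrow> P q' \<Longrightarrow> P (q * q')"
    and nonzero: "\<And>q. P q \<Longrightarrow> q \<noteq> 0"
  shows "\<exists>g. P g \<and> (\<forall>x\<in>X. to_mfrac g * x \<in> range to_mfrac)"
  using assms(1,2)
proof (induction X rule: finite_induct)
  case empty
  then show ?case using one by blast
next
  case (insert x X)
  then obtain g where g: "P g" "\<And>y. y \<in> X \<Longrightarrow> to_mfrac g * y \<in> range to_mfrac"
    by blast
  obtain p q where q: "x = to_mfrac p / to_mfrac q" "P q"
    using insert.prems by blast
  have "to_mfrac (g * q) * x = to_mfrac (g * p)"
    using nonzero[OF q(2)] by (simp add: q(1) to_mfrac_mult)
  moreover have "to_mfrac (g * q) * y \<in> range to_mfrac" if y: "y \<in> X" for y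
  proof -
    obtain s where "to_mfrac g * y = to_mfrac s"
      using g(2)[OF y] by blast
    then have "to_mfrac (g * q) * y = to_mfrac (s * q)"
      by (simp add: to_mfrac_mult mult_ac)
    then show ?thesis by simp
  qed
  ultimately show ?case
    using mult[OF g(1) q(2)] by (intro exI[of _ "g * q"]) auto
qed

definition localization_away :: "'n mpoly \<Rightarrow> (('n::{finite,linorder}) mfrac) set" where
  "localization_away q = {to_mfrac f / to_mfrac (q ^ k) | f k. True}"

context
  fixes q :: "('n::{finite,linorder}) mpoly"
  assumes q: "q \<noteq> 0"
begin

lemma away_to_mfrac [simp]: "to_mfrac p \<in> localization_away q"
proof -
  have "to_mfrac p = to_mfrac p / to_mfrac (q ^ 0)" by simp
  then show ?thesis
    unfolding localization_away_def by blast
qed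

lemma away_mult:
  assumes "x \<in> localization_away q" "y \<in> localization_away q"
  shows "x * y \<in> localization_away q"
proof -
  obtain f k g l where "x = to_mfrac f / to_mfrac (q ^ k)" "y = to_mfrac g / to_mfrac (q ^ l)"
    using assms by (auto simp: localization_away_def)
  then have "x * y = to_mfrac (f * g) / to_mfrac (q ^ (k + l))"
    by (simp add: to_mfrac_mult power_add)
  then show ?thesis
    unfolding localization_away_def by blast
qed

lemma away_add:
  assumes "x \<in> localization_away q" "y \<in> localization_away q"
  shows "x + y \<in> localization_away q"
proof -
  obtain f k g l where "x = to_mfrac f / to_mfrac (q ^ k)" "y = to_mfrac g / to_mfrac (q ^ l)"
    using assms by (auto simp: localization_away_def)
  then have "x + y = to_mfrac (f * q ^ l + g * q ^ k) / to_mfrac (q ^ (k + l))"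
    using q by (simp add: to_mfrac_mult to_mfrac_add power_add add_frac_eq)
  then show ?thesis
    unfolding localization_away_def by blast
qed

lemma away_sum: "(\<And>i. i \<in> A \<Longrightarrow> f i \<in> localization_away q) \<Longrightarrow> (\<Sum>i\<in>A. f i) \<in> localization_away q"
  using away_to_mfrac[of 0]
  by (induction A rule: infinite_finite_induct) (auto intro: away_add)

lemma away_der_apply:
  assumes "x \<in> localization_away q" "\<And>i. \<theta> $ i \<in> localization_away q"
  shows "der_apply \<theta> x \<in> localization_away q"
proof -
  obtain f k where x: "x = to_mfrac f / to_mfrac (q ^ k)"
    using assms(1) by (auto simp: localization_away_def)
  have qk: "q ^ k \<noteq> 0" using q by simp
  have sq: "q ^ k * q ^ k = q ^ (k + k)"
    by (simp add: power_add)
  have "mfrac_pderiv i x =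
      to_mfrac (mpoly_pderiv i f * q ^ k - f * mpoly_pderiv i (q ^ k)) / to_mfrac (q ^ (k + k))" for i
    unfolding x mfrac_pderiv_quotient[OF qk] to_mfrac_diff to_mfrac_mult sq[symmetric] ..
  then have "mfrac_pderiv i x \<in> localization_away q" for i
    unfolding localization_away_def by blast
  then show ?thesis
    unfolding der_apply_def by (intro away_sum away_mult assms)
qed

lemma away_inverse:
  assumes "p dvd q"
  shows "inverse (to_mfrac p) \<in> localization_away q"
proof -
  obtain s where s: "q = p * s"
    using assms ..
  then have "inverse (to_mfrac p) = to_mfrac s / to_mfrac (q ^ 1)"
    using q by (simp add: to_mfrac_mult field_simps)
  then show ?thesis
    unfolding localization_away_def by blast
qed

end

lemma powi_closed:
  fixes x :: "'a::field"
  assumes "1 \<in> A" "\<And>u v. u \<in> A \<Longrightarrow> v \<in> A \<Longrightarrow> u * v \<in> A" "x \<in> A" "inverse x \<in> A"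
  shows "x powi k \<in> A"
proof -
  have "y ^ n \<in> A" if "y \<in> A" for y n
    using that assms(1,2) by (induction n) auto
  then show ?thesis
    using assms(3,4) by (simp add: power_int_def)
qed

context hyperplane
begin

lemma dvd_prod_iff: "finite B \<Longrightarrow> linear_poly a dvd (\<Prod>x\<in>B. f x) \<longleftrightarrow> (\<exists>x\<in>B. linear_poly a dvd f x)"
  by (induction B rule: finite_induct) (auto simp: dvd_mult_iff not_dvd_1)

lemma dvd_powerD: "linear_poly a dvd p ^ k \<Longrightarrow> linear_poly a dvd p"
  by (induction k) (auto simp: dvd_mult_iff not_dvd_1)

lemma R_common_denominator:
  assumes "finite X" "X \<subseteq> R"
  shows "\<exists>g. \<not> linear_poly a dvd g \<and> (\<forall>x\<in>X. to_mfrac g * x \<in> range to_mfrac)"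
proof (rule common_denominator)
  show "\<exists>p q. x = to_mfrac p / to_mfrac q \<and> \<not> linear_poly a dvd q" if "x \<in> X" for x
    using that assms(2) by (blast elim: R_E)
qed (use assms(1) in \<open>auto simp: dvd_mult_iff not_dvd_1\<close>)

lemma local_derI_coeffs:
  assumes "m \<le> k" "0 \<le> k" "\<And>i. \<eta> $ i \<in> frac_ideal a k"
  shows "\<eta> \<in> local_der a r m"
proof -
  have "der_apply \<eta> (lin b) \<in> frac_ideal a k" for b
    unfolding der_apply_lin by (intro frac_ideal_sum frac_ideal_mult_R R_to_mfrac assms)
  then show ?thesis
    using assms(1,2) frac_ideal_mono[of m k] frac_ideal_mono[of 0 k] by (simp add: local_der_def)
qed

lemma local_der_zero: "0 \<in> local_der a r m"
  by (simp add: local_der_def der_apply_def)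

end

section \<open>Stabilizers of reflecting hyperplanes\<close>

lemma matrix_inv_props:
  assumes "invertible w"
  shows "matrix_inv w ** w = mat 1" "w ** matrix_inv w = mat 1"
  using assms unfolding invertible_def matrix_inv_def by (metis (mono_tags, lifting) someI_ex)+

lemma matrix_inv_unique_left:
  fixes M w :: "('n::finite) cmat"
  assumes "M ** w = mat 1" "w ** M = mat 1"
  shows "matrix_inv w = M"
proof -
  have inv: "invertible w"
    using assms unfolding invertible_def by blast
  have "matrix_inv w = M ** (w ** matrix_inv w)"
    by (simp add: matrix_mul_assoc assms(1))
  then show ?thesis
    by (simp add: matrix_inv_props[OF inv])
qed

context hyperplane
begin

lemma acts_as_homothety_inv:
  assumes w: "acts_as_homothety w c"
  shows "acts_as_homothety (matrix_inv w) (1 / c)"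
proof -
  have inv: "invertible w" and M: "\<And>v. matrix_inv w *v v = v + ((c - 1) * linear_form a v) *s r"
    using w by (auto simp: acts_as_homothety_def)
  note props = matrix_inv_props[OF inv]
  have c: "c \<noteq> 0"
    using w by (rule ratio_nonzero)
  have "w *v v = v + ((1 / c - 1) * linear_form a v) *s r" for v
  proof -
    define u where "u = v + ((1 / c - 1) * linear_form a v) *s r"
    have "linear_form a u = linear_form a v + (1 / c - 1) * linear_form a v * linear_form a r"
      unfolding u_def by (rule linear_form_add_right)
    then have u: "linear_form a u = linear_form a v / c"
      by (simp add: normalized algebra_simps)
    have "matrix_inv w *v u = u + ((c - 1) * (linear_form a v / c)) *s r"
      unfolding M u ..
    also have "\<dots> = v + (((1 / c - 1) + (c - 1) / c) * linear_form a v) *s r"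
      by (simp add: u_def vec_eq_iff algebra_simps)
    also have "(1 / c - 1) + (c - 1) / c = 0"
      using c by (simp add: field_simps)
    finally have "matrix_inv w *v u = v"
      by simp
    then have "w *v v = (w ** matrix_inv w) *v u"
      by (simp add: matrix_vector_mul_assoc[symmetric])
    then show ?thesis
      by (simp add: props u_def)
  qed
  moreover have "invertible (matrix_inv w)"
    using props unfolding invertible_def by blast
  ultimately show ?thesis
    using matrix_inv_unique_left[of w "matrix_inv w"] props by (simp add: acts_as_homothety_def)
qed

text \<open>
  Linear forms that vanish at \<open>r\<close> are invariant under homotheties, and an invariant derivation
  maps invariants to invariants.
\<close>

lemma invariant_tangential:
  assumes w: "acts_as_homothety w c" and b: "linear_form b r = 0"
    and inv: "\<And>f. act_mfrac w (der_apply \<zeta> (act_mfrac (matrix_inv w) f)) = der_apply \<zeta> f"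
  shows "act_mfrac w (der_apply \<zeta> (lin b)) = der_apply \<zeta> (lin b)"
proof -
  note w' = acts_as_homothety_inv[OF w]
  have "act_mfrac (matrix_inv w) (lin b) = lin b"
    using w' act_mfrac_to_mfrac[of "matrix_inv w" "linear_poly b"]
    by (simp add: act_mpoly_homothety homothety_linear_poly b) (simp add: acts_as_homothety_def)
  then show ?thesis
    using inv[of "lin b"] by simp
qed

lemma invariant_normal:
  assumes w: "acts_as_homothety w c"
    and inv: "\<And>f. act_mfrac w (der_apply \<zeta> (act_mfrac (matrix_inv w) f)) = der_apply \<zeta> f"
  shows "act_mfrac w (der_apply \<zeta> t) = cst c * der_apply \<zeta> t"
proof -
  have iw: "invertible w"
    using w by (simp add: acts_as_homothety_def)
  have "act_mfrac w (der_apply \<zeta> (cst (1 / c) * t)) = der_apply \<zeta> t"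
    using inv[of t] unfolding act_t[OF acts_as_homothety_inv[OF w]] .
  then have "cst (1 / c) * act_mfrac w (der_apply \<zeta> t) = der_apply \<zeta> t"
    by (simp add: der_apply_mult act_mfrac_mult[OF iw] act_mfrac_cst[OF iw])
  then have "cst c * der_apply \<zeta> t = cst c * cst (1 / c) * act_mfrac w (der_apply \<zeta> t)"
    by (simp add: mult.assoc)
  also have "cst c * cst (1 / c) = (1 :: 'n mfrac)"
    unfolding to_mfrac_mult[symmetric] mpoly_const_mult[symmetric] using ratio_nonzero[OF w] by simp
  finally show ?thesis
    by simp
qed

end

locale reflection_data =
  fixes W :: "(('n::{finite,linorder}) cmat) set"
    and I :: "'n cvec \<Rightarrow> 'n cvec \<Rightarrow> complex"
    and \<alpha> :: "'n cvec set \<Rightarrow> 'n cvec"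
  assumes finite_W: "finite W" and subgroup_W: "subgroup W GL"
    and hermitian: "hermitian_inner_product I"
    and invariant: "invariant_form W I"
    and defining: "defining_forms W I \<alpha>"
begin

abbreviation "arr \<equiv> refl_arrangement W"

lemma finite_arr: "finite arr"
  using finite_W by (simp add: refl_arrangement_def)

lemma I_riesz: "I v (riesz I a) = linear_form a v"
  using theI'[OF riesz_ex1[OF hermitian, of a]] unfolding riesz_def by metis

lemma dual_form_eq_0_iff: "dual_form I a b = 0 \<longleftrightarrow> linear_form b (riesz I a) = 0"
proof -
  have "I (riesz I b) (riesz I a) = cnj (I (riesz I a) (riesz I b))"
    using hermitian unfolding hermitian_inner_product_def by blast
  then show ?thesis
    by (simp add: dual_form_def I_riesz)
qed

lemma hyperplane_arr:
  assumes "H \<in> arr"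
  shows "hyperplane (\<alpha> H) (riesz I (\<alpha> H))"
  using assms defining by unfold_locales (simp add: defining_forms_def dual_form_def I_riesz)

lemma mem_hyperplane_iff:
  assumes "H \<in> arr"
  shows "v \<in> H \<longleftrightarrow> linear_form (\<alpha> H) v = 0"
  using assms defining unfolding defining_forms_def by blast

lemma D_mult_iff:
  "\<theta> \<in> D_mult W I \<alpha> m \<longleftrightarrow>
     (\<forall>i. \<theta> $ i \<in> localization_away (arr_poly W \<alpha>)) \<and>
     (\<forall>H\<in>arr. \<theta> \<in> local_der (\<alpha> H) (riesz I (\<alpha> H)) (m H))"
  unfolding D_mult_def D_minus_infinity_def Der_S'_def local_der_def frac_ideal_def
    localization_away_def dual_form_eq_0_iff Fract_to_mfrac
  by blast

lemma not_dvd_distinct: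
  assumes H: "H \<in> arr" and H': "H' \<in> arr" and "H \<noteq> H'"
  shows "\<not> linear_poly (\<alpha> H) dvd linear_poly (\<alpha> H')"
proof
  assume dvd: "linear_poly (\<alpha> H) dvd linear_poly (\<alpha> H')"
  interpret h: hyperplane "\<alpha> H" "riesz I (\<alpha> H)"
    using H by (rule hyperplane_arr)
  interpret h': hyperplane "\<alpha> H'" "riesz I (\<alpha> H')"
    using H' by (rule hyperplane_arr)
  define c where "c = linear_form (\<alpha> H') (riesz I (\<alpha> H))"
  have "linear_poly (\<alpha> H' - c *s \<alpha> H) = 0"
    using dvd by (simp add: h.linear_poly_dvd_iff h.homothety_linear_poly linear_poly_diff_smult
        c_def mpoly_const_minus)
  then have eq: "\<alpha> H' = c *s \<alpha> H"
    by (simp add: linear_poly_eq_0_iff)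
  have lf: "linear_form (\<alpha> H') v = c * linear_form (\<alpha> H) v" for v
    by (simp add: eq linear_form_def sum_distrib_left mult.assoc)
  have "c \<noteq> 0"
    using h'.normalized by (auto simp: lf)
  then have "v \<in> H' \<longleftrightarrow> v \<in> H" for v
    by (simp add: mem_hyperplane_iff H H' lf)
  then show False
    using \<open>H \<noteq> H'\<close> by blast
qed

lemma arr_poly_split:
  assumes "H \<in> arr"
  shows "arr_poly W \<alpha> = linear_poly (\<alpha> H) * (\<Prod>H'\<in>arr - {H}. linear_poly (\<alpha> H'))"
  unfolding arr_poly_def by (rule prod.remove[OF finite_arr assms])

lemma not_dvd_others:
  assumes "H \<in> arr"
  shows "\<not> linear_poly (\<alpha> H) dvd (\<Prod>H'\<in>arr - {H}. linear_poly (\<alpha> H'))"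
proof -
  interpret hyperplane "\<alpha> H" "riesz I (\<alpha> H)"
    using assms by (rule hyperplane_arr)
  show ?thesis
    using finite_arr not_dvd_distinct[OF assms] by (auto simp: dvd_prod_iff)
qed

lemma arr_poly_nonzero: "arr_poly W \<alpha> \<noteq> 0"
proof -
  have "linear_poly (\<alpha> H) \<noteq> 0" if "H \<in> arr" for H
    using hyperplane.linear_poly_nonzero[OF hyperplane_arr[OF that]] .
  then show ?thesis
    unfolding arr_poly_def using finite_arr by simp
qed

lemma away_pole:
  assumes "H \<in> arr" "x \<in> localization_away (arr_poly W \<alpha>)"
  shows "\<exists>N. x \<in> frac_ideal (\<alpha> H) (- int N)"
proof -
  interpret hyperplane "\<alpha> H" "riesz I (\<alpha> H)"
    using assms(1) by (rule hyperplane_arr)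
  define P where "P = (\<Prod>H'\<in>arr - {H}. linear_poly (\<alpha> H'))"
  obtain f k where x: "x = to_mfrac f / to_mfrac (arr_poly W \<alpha> ^ k)"
    using assms(2) by (auto simp: localization_away_def)
  have "t powi (int k) * x = to_mfrac f / to_mfrac (P ^ k)"
    by (simp add: x arr_poly_split[OF assms(1)] P_def[symmetric] power_mult_distrib to_mfrac_mult
        to_mfrac_power)
  moreover have "\<not> linear_poly (\<alpha> H) dvd P ^ k"
    using not_dvd_others[OF assms(1)] dvd_powerD unfolding P_def by blast
  ultimately have "t powi (- (- int k)) * x \<in> R"
    using R_I by simp
  then show ?thesis
    by (auto simp only: frac_ideal_iff)
qed

definition stabilizer :: "'n cvec set \<Rightarrow> 'n cmat set" where
  "stabilizer H = {w \<in> W. \<forall>v\<in>H. w *v v = v}"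

definition ratio :: "'n cvec set \<Rightarrow> 'n cmat \<Rightarrow> complex" where
  "ratio H w = linear_form (\<alpha> H) (matrix_inv w *v riesz I (\<alpha> H))"

lemma invertible_W: "w \<in> W \<Longrightarrow> invertible w"
  using subgroup.subset[OF subgroup_W] by (auto simp: GL_def)

text \<open>
  The inverse \<open>M\<close> of \<open>w\<close> also fixes \<open>H\<close> pointwise and preserves the form \<open>I\<close>, so it maps the
  orthogonal vector \<open>r\<close> of \<open>H\<close> to a multiple of itself: the difference of \<open>M r\<close> and that
  multiple lies in \<open>H\<close> and is orthogonal to \<open>H\<close>.
\<close>

lemma stabilizer_homothety:
  assumes H: "H \<in> arr" and w: "w \<in> stabilizer H"
  shows "hyperplane.acts_as_homothety (\<alpha> H) (riesz I (\<alpha> H)) w (ratio H w)"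
proof -
  interpret hyperplane "\<alpha> H" "riesz I (\<alpha> H)"
    using H by (rule hyperplane_arr)
  define r where "r = riesz I (\<alpha> H)"
  define M where "M = matrix_inv w"
  define c where "c = ratio H w"
  define d where "d = M *v r - c *s r"
  have wW: "w \<in> W" and fix_H: "\<And>v. v \<in> H \<Longrightarrow> w *v v = v"
    using w by (simp_all add: stabilizer_def)
  have inv: "invertible w"
    using wW by (rule invertible_W)
  have Mfix: "M *v v = v" if "v \<in> H" for v
  proof -
    have "M *v v = (M ** w) *v v"
      by (simp add: matrix_vector_mul_assoc[symmetric] fix_H[OF that])
    then show ?thesis
      by (simp add: M_def matrix_inv_props[OF inv])
  qed
  have addI: "I (u + u') v = I u v + I u' v" and scI: "I (x *s u) v = x * I u v"
    and symI: "I v u = cnj (I u v)" and posI: "u \<noteq> 0 \<Longrightarrow> Re (I u u) > 0" for u u' v x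
    using hermitian unfolding hermitian_inner_product_def by blast+
  have "linear_form (\<alpha> H) d = 0"
    by (simp add: d_def linear_form_diff_right c_def ratio_def M_def r_def normalized)
  then have dH: "d \<in> H" and "I d r = 0"
    by (simp_all add: mem_hyperplane_iff[OF H] r_def I_riesz)
  then have rd: "I r d = 0"
    using symI[of r d] by simp
  have "I (M *v r) d = I (w *v (M *v r)) (w *v d)"
    using invariant wW by (simp add: invariant_form_def)
  also have "\<dots> = I r d"
    by (simp add: matrix_vector_mul_assoc M_def matrix_inv_props[OF inv] fix_H[OF dH])
  finally have Md: "I (M *v r) d = 0"
    by (simp add: rd)
  have "I (M *v r + (- c) *s r) d = 0"
    by (simp only: addI scI Md rd) simp
  then have "I d d = 0"
    by (simp add: d_def)
  then have "d = 0"
    using posI[of d] by auto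
  then have Mr: "M *v r = c *s r"
    by (simp add: d_def)
  have "M *v v = v + ((c - 1) * linear_form (\<alpha> H) v) *s r" for v
  proof -
    define x where "x = linear_form (\<alpha> H) v"
    have "v - x *s r \<in> H"
      by (simp add: mem_hyperplane_iff[OF H] linear_form_diff_right x_def r_def normalized)
    then have "M *v (v - x *s r) = v - x *s r"
      by (rule Mfix)
    moreover have "M *v v = M *v (v - x *s r) + M *v (x *s r)"
      by (simp flip: matrix_vector_right_distrib)
    moreover have "M *v (x *s r) = x *s (c *s r)"
      by (simp add: vector_scalar_commute Mr)
    ultimately have Mv: "M *v v = (v - x *s r) + x *s (c *s r)"
      by (simp only:)
    show ?thesis
      unfolding Mv x_def[symmetric] by (simp add: vec_eq_iff algebra_simps)
  qed
  then show ?thesis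
    using inv by (simp add: acts_as_homothety_def M_def c_def r_def)
qed

text \<open>
  An element of the stabilizer is a homothety, hence determined by its ratio. The order estimate
  for semi-invariants needs as many distinct ratios as the stabilizer has elements.
\<close>

lemma inj_on_ratio:
  assumes H: "H \<in> arr"
  shows "inj_on (ratio H) (stabilizer H)"
proof (rule inj_onI)
  fix w w' assume w: "w \<in> stabilizer H" "w' \<in> stabilizer H" "ratio H w = ratio H w'"
  interpret hyperplane "\<alpha> H" "riesz I (\<alpha> H)"
    using H by (rule hyperplane_arr)
  have inv: "invertible w" "invertible w'"
    using w invertible_W by (auto simp: stabilizer_def)
  have "matrix_inv w *v v = matrix_inv w' *v v" for v
    using stabilizer_homothety[OF H w(1)] stabilizer_homothety[OF H w(2)] w(3)
    by (simp add: acts_as_homothety_def)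
  then have eq: "matrix_inv w = matrix_inv w'"
    by (simp add: matrix_eq)
  have "w = w ** (matrix_inv w' ** w')"
    unfolding matrix_inv_props[OF inv(2)] by simp
  also have "\<dots> = w'"
    unfolding eq[symmetric] matrix_mul_assoc matrix_inv_props[OF inv(1)] by simp
  finally show "w = w'" .
qed

text \<open>
  A reflection has a fixed space of positive codimension, so it differs from the identity.
\<close>

lemma card_stabilizer:
  assumes H: "H \<in> arr"
  shows "card (stabilizer H) \<ge> 2"
proof -
  obtain s where s: "s \<in> W" "is_reflection s" "H = fixed_space s"
    using H by (auto simp: refl_arrangement_def)
  have "mat 1 \<in> W"
    using subgroup.one_closed[OF subgroup_W] by (simp add: GL_def)
  then have sub: "{mat 1, s} \<subseteq> stabilizer H"
    using s by (auto simp: stabilizer_def fixed_space_def)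
  have "s \<noteq> mat 1"
  proof
    assume "s = mat 1"
    then have "vec.dim (UNIV :: 'n cvec set) + 1 = CARD('n)"
      using s(2) by (simp add: is_reflection_def fixed_space_def)
    then show False
      unfolding vec_dim_card by simp
  qed
  then have "card {mat 1, s} = 2"
    by auto
  then show ?thesis
    using card_mono[OF _ sub] finite_W by (simp add: stabilizer_def)
qed

section \<open>Modules of multiderivations\<close>

lemma inverse_lin_away:
  assumes "H \<in> arr"
  shows "inverse (lin (\<alpha> H)) \<in> localization_away (arr_poly W \<alpha>)"
  by (rule away_inverse[OF arr_poly_nonzero]) (simp add: arr_poly_split[OF assms])

lemma subspace_D_mult: "der.subspace (D_mult W I \<alpha> m)"
proof (rule der.subspaceI)
  show "0 \<in> D_mult W I \<alpha> m"
    using away_to_mfrac[OF arr_poly_nonzero, of 0]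
    by (auto simp: D_mult_iff intro: hyperplane.local_der_zero[OF hyperplane_arr])
next
  fix \<theta> \<eta> assume "\<theta> \<in> D_mult W I \<alpha> m" "\<eta> \<in> D_mult W I \<alpha> m"
  then show "\<theta> + \<eta> \<in> D_mult W I \<alpha> m"
    by (auto simp: D_mult_iff intro: hyperplane.local_der_add[OF hyperplane_arr] away_add[OF arr_poly_nonzero])
next
  fix s \<theta> assume "\<theta> \<in> D_mult W I \<alpha> m"
  then show "der_scale s \<theta> \<in> D_mult W I \<alpha> m"
    unfolding der_scale_smult
    by (auto simp: D_mult_iff intro!: hyperplane.local_der_scale[OF hyperplane_arr]
        away_mult[OF arr_poly_nonzero] away_to_mfrac[OF arr_poly_nonzero] hyperplane.R_to_mfrac[OF hyperplane_arr])
qed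

text \<open>
  Any common upper bound for the multiplicities would serve.
\<close>

definition order_bound :: "('n cvec set \<Rightarrow> int) \<Rightarrow> nat" where
  "order_bound m = (\<Sum>H\<in>arr. nat \<bar>m H\<bar>)"

lemma order_bound:
  assumes "H \<in> arr"
  shows "m H \<le> int (order_bound m)"
proof -
  have "nat \<bar>m H\<bar> \<le> order_bound m"
    unfolding order_bound_def using finite_arr assms by (intro member_le_sum) simp_all
  then show ?thesis by linarith
qed

text \<open>
  After clearing the denominators, which are powers of the arrangement polynomial, a further
  power of it makes all coefficients vanish to high order along every hyperplane.
\<close>

lemma D_mult_clear_pole:
  assumes "\<And>i. \<eta> $ i \<in> localization_away (arr_poly W \<alpha>)"
  shows "\<exists>k. to_mfrac (arr_poly W \<alpha> ^ k) *s \<eta> \<in> D_mult W I \<alpha> m"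
proof -
  let ?Q = "arr_poly W \<alpha>"
  have "\<exists>g. (\<exists>k. g = ?Q ^ k) \<and> (\<forall>x\<in>range (($) \<eta>). to_mfrac g * x \<in> range to_mfrac)"
  proof (rule common_denominator)
    fix x assume "x \<in> range (($) \<eta>)"
    then show "\<exists>p q. x = to_mfrac p / to_mfrac q \<and> (\<exists>k. q = ?Q ^ k)"
      using assms unfolding localization_away_def by blast
  next
    show "\<exists>k. 1 = ?Q ^ k" by (rule exI[of _ 0]) simp
  next
    fix q q' assume "\<exists>k. q = ?Q ^ k" "\<exists>k. q' = ?Q ^ k"
    then show "\<exists>k. q * q' = ?Q ^ k" by (metis power_add)
  qed (use arr_poly_nonzero in auto)
  then obtain k where k: "\<And>i. to_mfrac (?Q ^ k) * \<eta> $ i \<in> range to_mfrac"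
    by blast
  define N where "N = order_bound m"
  have coeff: "\<exists>p. (to_mfrac (?Q ^ (N + k)) *s \<eta>) $ i = to_mfrac (?Q ^ N) * to_mfrac p" for i
    using k[of i] by (auto simp: power_add to_mfrac_mult mult.assoc)
  have "to_mfrac (?Q ^ (N + k)) *s \<eta> \<in> local_der (\<alpha> H) (riesz I (\<alpha> H)) (m H)" if H: "H \<in> arr" for H
  proof -
    interpret hyperplane "\<alpha> H" "riesz I (\<alpha> H)"
      using H by (rule hyperplane_arr)
    have "to_mfrac (?Q ^ N) * to_mfrac p \<in> frac_ideal (\<alpha> H) (int N)" for p
    proof -
      have "to_mfrac (?Q ^ N) * to_mfrac p =
          t ^ N * to_mfrac ((\<Prod>H'\<in>arr - {H}. linear_poly (\<alpha> H')) ^ N * p)"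
        by (simp add: arr_poly_split[OF H] power_mult_distrib to_mfrac_mult to_mfrac_power mult.assoc)
      also have "\<dots> \<in> frac_ideal (\<alpha> H) (int N + 0)"
        using t_powi_in[of "int N"] by (intro frac_ideal_mult) (simp_all del: t_powi_in)
      finally show ?thesis by simp
    qed
    then show ?thesis
      using order_bound[OF H, of m] coeff unfolding N_def
      by (intro local_derI_coeffs[of _ "int (order_bound m)"]) (simp, simp, metis)
  qed
  moreover have "(to_mfrac (?Q ^ (N + k)) *s \<eta>) $ i \<in> localization_away ?Q" for i
    using coeff[of i] away_to_mfrac[OF arr_poly_nonzero] away_mult[OF arr_poly_nonzero] by metis
  ultimately have "to_mfrac (?Q ^ (N + k)) *s \<eta> \<in> D_mult W I \<alpha> m"
    by (simp only: D_mult_iff) blast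
  then show ?thesis
    by blast
qed

text \<open>
  A derivation subject only to the condition at \<open>H\<close> becomes an element of \<open>D_mult\<close> after
  multiplication with a polynomial that is a unit at \<open>H\<close>: a denominator of its components at
  \<open>H\<close>, times a power of the product \<open>P\<close> of the other linear forms, which takes care of the
  other hyperplanes. Through this lemma the global surjectivity of \<open>nabla\<close> passes to the local
  rings.
\<close>

lemma local_der_clear_denominator:
  assumes H: "H \<in> arr" and \<eta>: "\<eta> \<in> local_der (\<alpha> H) (riesz I (\<alpha> H)) (m H)"
  shows "\<exists>g. \<not> linear_poly (\<alpha> H) dvd g \<and> to_mfrac g *s \<eta> \<in> D_mult W I \<alpha> m"
proof -
  interpret hyperplane "\<alpha> H" "riesz I (\<alpha> H)"
    using H by (rule hyperplane_arr)
  let ?Q = "arr_poly W \<alpha>"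
  define P where "P = (\<Prod>H'\<in>arr - {H}. linear_poly (\<alpha> H'))"
  define N where "N = order_bound m"
  obtain u where u: "u \<in> R" "der_apply \<eta> t = t powi m H * u"
    using \<eta> by (auto simp: local_der_def frac_ideal_def)
  have sub: "insert u (range (($) (tangential \<eta>))) \<subseteq> R"
    using u(1) \<eta> by (auto simp: local_der_iff)
  obtain g where g: "\<not> linear_poly (\<alpha> H) dvd g"
      "\<forall>x\<in>insert u (range (($) (tangential \<eta>))). to_mfrac g * x \<in> range to_mfrac"
    using R_common_denominator[OF _ sub] by auto
  obtain v where v: "to_mfrac g * u = to_mfrac v"
    using g(2) by blast
  have "\<forall>i. \<exists>p. to_mfrac g * tangential \<eta> $ i = to_mfrac p"
    using g(2) by blast
  then obtain p where p: "\<And>i. to_mfrac g * tangential \<eta> $ i = to_mfrac (p i)"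
    by metis
  \<comment> \<open>These components are regular away from \<open>H\<close>, with at most a power of \<open>t\<close> in the denominator.\<close>
  define e where "e i = t powi m H * (to_mfrac v * normal_der $ i) + to_mfrac (p i)" for i
  have ge: "to_mfrac g * \<eta> $ i = e i" for i
  proof -
    have "\<eta> $ i = (der_apply \<eta> t *s normal_der + tangential \<eta>) $ i"
      by (simp only: tangential_decomp[symmetric])
    then have "to_mfrac g * \<eta> $ i =
        t powi m H * ((to_mfrac g * u) * normal_der $ i) + to_mfrac g * tangential \<eta> $ i"
      by (simp add: u(2) distrib_left mult_ac)
    then show ?thesis
      by (simp only: v p e_def)
  qed
  define g' where "g' = g * P ^ N"
  have coeff: "(to_mfrac g' *s \<eta>) $ i = to_mfrac (P ^ N) * e i" for i
    by (simp add: g'_def to_mfrac_mult flip: ge)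
  have "\<not> linear_poly (\<alpha> H) dvd P ^ N"
    using not_dvd_others[OF H] dvd_powerD unfolding P_def by blast
  then have g': "\<not> linear_poly (\<alpha> H) dvd g'"
    using g(1) by (simp add: g'_def dvd_mult_iff)
  have "to_mfrac g' *s \<eta> \<in> local_der (\<alpha> K) (riesz I (\<alpha> K)) (m K)" if K: "K \<in> arr" for K
  proof (cases "K = H")
    case True
    then show ?thesis
      using local_der_scale[OF R_to_mfrac \<eta>] by simp
  next
    case False
    interpret k: hyperplane "\<alpha> K" "riesz I (\<alpha> K)"
      using K by (rule hyperplane_arr)
    have "t powi m H \<in> k.R"
      using not_dvd_distinct[OF K H False]
      by (intro powi_closed k.R_mult k.R_inverse_to_mfrac) simp_all
    then have e: "e i \<in> k.R" for i
      unfolding e_def by (intro k.R_add k.R_mult) (simp_all add: normal_der_def)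
    have "to_mfrac (P ^ N) \<in> frac_ideal (\<alpha> K) (int N)"
    proof -
      have "P = linear_poly (\<alpha> K) * (\<Prod>H'\<in>arr - {H} - {K}. linear_poly (\<alpha> H'))"
        unfolding P_def using finite_arr K False by (intro prod.remove) auto
      then have "to_mfrac (P ^ N) =
          to_mfrac ((\<Prod>H'\<in>arr - {H} - {K}. linear_poly (\<alpha> H')) ^ N) * k.t powi (int N)"
        by (simp add: power_mult_distrib to_mfrac_mult to_mfrac_power)
      then show ?thesis
        by (simp only: k.frac_ideal_mult_R[OF k.R_to_mfrac k.t_powi_in])
    qed
    then have "e i * to_mfrac (P ^ N) \<in> frac_ideal (\<alpha> K) (int N)" for i
      using e by (intro k.frac_ideal_mult_R)
    then show ?thesis
      using order_bound[OF K, of m] unfolding N_def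
      by (intro k.local_derI_coeffs[of _ "int (order_bound m)"])
        (simp_all only: coeff[unfolded N_def] mult.commute[of "e _"] of_nat_0_le_iff)
  qed
  moreover have "(to_mfrac g' *s \<eta>) $ i \<in> localization_away ?Q" for i
  proof -
    note away = away_to_mfrac[OF arr_poly_nonzero] away_mult[OF arr_poly_nonzero]
      away_add[OF arr_poly_nonzero]
    have "1 \<in> localization_away ?Q"
      using away(1)[of 1] by simp
    then have "t powi m H \<in> localization_away ?Q"
      by (intro powi_closed away inverse_lin_away H)
    then have "e i \<in> localization_away ?Q"
      unfolding e_def normal_der_def by (intro away) (simp_all add: away)
    then show ?thesis
      unfolding coeff by (intro away)
  qed
  ultimately show ?thesis
    using g' by (auto simp: D_mult_iff)
qed

end

section \<open>Universal derivations\<close>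

lemma free_submodule_image_iff:
  assumes "module_hom der_scale der_scale \<phi>" and inj: "inj \<phi>"
  shows "free_submodule (\<phi> ` M) \<longleftrightarrow> free_submodule M"
proof -
  interpret h: module_hom der_scale der_scale \<phi> by (rule assms(1))
  note independent_image = h.independent_injective_image[folded der_dependent_def der_span_def]
    and span_image = h.span_image[folded der_span_def]
  have "free_submodule (\<phi> ` M)" if "free_submodule M"
  proof -
    obtain B where B: "\<not> der.dependent B" "der.span B = M"
      using \<open>free_submodule M\<close> by (auto simp: free_submodule_def)
    have "\<not> der.dependent (\<phi> ` B)"
      by (rule independent_image[OF B(1) inj_on_subset[OF inj]]) simp
    moreover have "der.span (\<phi> ` B) = \<phi> ` M"
      by (simp add: span_image B(2))
    ultimately show ?thesis
      unfolding free_submodule_def by blast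
  qed
  moreover have "free_submodule M" if "free_submodule (\<phi> ` M)"
  proof -
  obtain B' where B': "\<not> der.dependent B'" "der.span B' = \<phi> ` M"
    using \<open>free_submodule (\<phi> ` M)\<close> by (auto simp: free_submodule_def)
  define B where "B = \<phi> -` B'"
  have "B' \<subseteq> \<phi> ` M"
    using B'(2) der.span_superset by blast
  then have BB': "\<phi> ` B = B'"
    by (auto simp: B_def)
  then have "\<phi> ` der.span B = \<phi> ` M"
    using B'(2) by (simp flip: span_image)
  then have "der.span B = M"
    using inj by (simp add: inj_image_eq_iff)
  moreover have "\<not> der.dependent B"
  proof
    assume "der.dependent B"
    then obtain T u where T: "finite T" "T \<subseteq> B" "(\<Sum>v\<in>T. der_scale (u v) v) = 0" "\<exists>v\<in>T. u v \<noteq> 0"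
      unfolding der.dependent_explicit by blast
    have injT: "inj_on \<phi> T"
      using inj by (rule inj_on_subset) simp
    have "(\<Sum>v\<in>\<phi> ` T. der_scale (u (the_inv \<phi> v)) v) = (\<Sum>v\<in>T. der_scale (u v) (\<phi> v))"
      using inj by (simp add: sum.reindex[OF injT] the_inv_f_f)
    also have "\<dots> = \<phi> (\<Sum>v\<in>T. der_scale (u v) v)"
      by (simp add: h.sum h.scale)
    also have "\<dots> = 0"
      by (simp add: T(3) h.zero)
    finally have "(\<Sum>v\<in>\<phi> ` T. der_scale (u (the_inv \<phi> v)) v) = 0" .
    moreover have "\<exists>v\<in>\<phi> ` T. u (the_inv \<phi> v) \<noteq> 0"
      using T(4) inj by (auto simp: the_inv_f_f)
    moreover have "finite (\<phi> ` T)" "\<phi> ` T \<subseteq> B'"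
      using T(1,2) BB' by auto
    ultimately have "der.dependent B'"
      unfolding der.dependent_explicit
      by (intro exI[of _ "\<phi> ` T"] exI[of _ "\<lambda>v. u (the_inv \<phi> v)"]) blast
    then show False
      using B'(1) by contradiction
  qed
  ultimately show ?thesis
    unfolding free_submodule_def by blast
  qed
  ultimately show ?thesis
    by blast
qed

locale universal_derivation = reflection_data W I \<alpha>
  for W :: "(('n::{finite,linorder}) cmat) set" and I \<alpha> +
  fixes \<nu> :: "'n cvec set \<Rightarrow> int" and \<zeta> :: "'n der"
  assumes \<zeta>_invariant: "der_invariant W \<zeta>" and \<zeta>_universal: "universal W I \<alpha> \<nu> \<zeta>"
begin

lemma nabla_bij_Der_S: "bij_betw (\<lambda>\<theta>. nabla \<theta> \<zeta>) Der_S (D_mult W I \<alpha> \<nu>)"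
  using \<zeta>_universal by (simp add: universal_def submodule_iso_def)

lemma nabla_surj:
  assumes "\<eta> \<in> D_mult W I \<alpha> \<nu>"
  obtains \<theta> where "\<theta> \<in> Der_S" "nabla \<theta> \<zeta> = \<eta>"
proof -
  have "\<eta> \<in> (\<lambda>\<theta>. nabla \<theta> \<zeta>) ` Der_S"
    using assms bij_betw_imp_surj_on[OF nabla_bij_Der_S] by simp
  then show ?thesis
    using that by blast
qed

lemma \<zeta>_mem: "\<zeta> \<in> D_minus_infinity W I \<alpha>"
  using \<zeta>_universal by (simp add: universal_def)

lemma \<zeta>_away: "\<zeta> $ i \<in> localization_away (arr_poly W \<alpha>)"
  using \<zeta>_mem unfolding D_minus_infinity_def Der_S'_def localization_away_def Fract_to_mfrac by blast

lemma nabla_zero [simp]: "nabla 0 \<zeta> = 0"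
  using nabla_diff[of 0 0 \<zeta>] by simp

text \<open>
  Universality gives injectivity on \<open>Der_S\<close>; linearity over the fraction field extends it.
\<close>

lemma nabla_eq_0D:
  assumes "nabla \<theta> \<zeta> = 0"
  shows "\<theta> = 0"
proof -
  have "\<exists>g. g \<noteq> 0 \<and> (\<forall>x\<in>range (($) \<theta>). to_mfrac g * x \<in> range to_mfrac)"
  proof (rule common_denominator)
    show "\<exists>p q. x = to_mfrac p / to_mfrac q \<and> q \<noteq> 0" for x :: "'n mfrac"
      by (rule mfrac_cases[of x]) blast
  qed auto
  then obtain g where g: "g \<noteq> 0" "to_mfrac g *s \<theta> \<in> Der_S"
    by (auto simp: Der_S_def)
  have "nabla (to_mfrac g *s \<theta>) \<zeta> = nabla 0 \<zeta>"
    using assms by (simp add: nabla_smult)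
  moreover have "0 \<in> (Der_S :: 'n der set)"
    using rangeI[of to_mfrac 0] by (simp add: Der_S_def)
  ultimately have "to_mfrac g *s \<theta> = 0"
    using g(2) nabla_bij_Der_S unfolding bij_betw_def inj_on_def by blast
  then show ?thesis
    using g(1) by (simp add: vec_eq_iff)
qed

lemma inj_nabla: "inj (\<lambda>\<theta>. nabla \<theta> \<zeta>)"
  by (rule injI) (metis nabla_diff nabla_eq_0D right_minus_eq)

lemma module_hom_nabla: "module_hom der_scale der_scale (\<lambda>\<theta>. nabla \<theta> \<zeta>)"
  by unfold_locales (simp_all add: nabla_add nabla_smult der_scale_smult)

text \<open>
  The two statements about all derivations that are regular at \<open>H\<close> come from \<open>Der_S\<close> and
  \<open>D_mult\<close>: a multiplier that is a unit at \<open>H\<close> makes a derivation global, and by linearity it can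
  be divided out after applying \<open>nabla\<close>.
\<close>

lemma local_universal:
  assumes H: "H \<in> arr"
  shows "local_universal (\<alpha> H) (riesz I (\<alpha> H)) \<zeta> (\<nu> H) (stabilizer H) (ratio H)"
proof -
  interpret hyperplane "\<alpha> H" "riesz I (\<alpha> H)"
    using H by (rule hyperplane_arr)
  have inv: "act_mfrac w (der_apply \<zeta> (act_mfrac (matrix_inv w) f)) = der_apply \<zeta> f"
    if "w \<in> stabilizer H" for w f
    using that \<zeta>_invariant by (simp add: der_invariant_def stabilizer_def)
  show ?thesis
  proof unfold_locales
    show "finite (stabilizer H)"
      using finite_W by (simp add: stabilizer_def)
    show "2 \<le> card (stabilizer H)"
      using H by (rule card_stabilizer)
    show "inj_on (ratio H) (stabilizer H)"
      using H by (rule inj_on_ratio)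
    show "acts_as_homothety w (ratio H w)" if "w \<in> stabilizer H" for w
      using H that by (rule stabilizer_homothety)
    then show "act_mfrac w (der_apply \<zeta> t) = cst (ratio H w) * der_apply \<zeta> t"
      and "linear_form b (riesz I (\<alpha> H)) = 0 \<Longrightarrow>
        act_mfrac w (der_apply \<zeta> (lin b)) = der_apply \<zeta> (lin b)"
      if "w \<in> stabilizer H" for w b
      using that by (blast intro: invariant_normal[OF _ inv] invariant_tangential[OF _ _ inv])+
    show "der_apply \<zeta> (lin b) \<in> R" if "linear_form b (riesz I (\<alpha> H)) = 0" for b
      using \<zeta>_mem H that by (simp add: D_minus_infinity_def dual_form_eq_0_iff)
    have "der_apply \<zeta> t \<in> localization_away (arr_poly W \<alpha>)"
      by (intro away_der_apply away_to_mfrac \<zeta>_away arr_poly_nonzero)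
    then show "\<exists>N. der_apply \<zeta> t \<in> frac_ideal (\<alpha> H) (- int N)"
      by (rule away_pole[OF H])
    show "nabla \<theta> \<zeta> \<in> local_der (\<alpha> H) (riesz I (\<alpha> H)) (\<nu> H)"
      if \<theta>: "\<theta> \<in> local_der (\<alpha> H) (riesz I (\<alpha> H)) 0" for \<theta>
    proof -
      have sub: "range (($) \<theta>) \<subseteq> R"
        using \<theta> by (auto simp: local_der_0_iff)
      obtain g where g: "\<not> linear_poly (\<alpha> H) dvd g"
          "\<forall>x\<in>range (($) \<theta>). to_mfrac g * x \<in> range to_mfrac"
        using R_common_denominator[OF _ sub] by auto
      then have "to_mfrac g *s \<theta> \<in> Der_S"
        by (simp add: Der_S_def)
      then have "nabla (to_mfrac g *s \<theta>) \<zeta> \<in> D_mult W I \<alpha> \<nu>"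
        using nabla_bij_Der_S by (auto simp: bij_betw_def)
      then have "to_mfrac g *s nabla \<theta> \<zeta> \<in> local_der (\<alpha> H) (riesz I (\<alpha> H)) (\<nu> H)"
        using H by (simp add: D_mult_iff nabla_smult)
      then have "inverse (to_mfrac g) *s (to_mfrac g *s nabla \<theta> \<zeta>) \<in>
          local_der (\<alpha> H) (riesz I (\<alpha> H)) (\<nu> H)"
        by (rule local_der_scale[OF R_inverse_to_mfrac[OF g(1)]])
      moreover have "g \<noteq> 0"
        using g(1) by auto
      ultimately show ?thesis
        by simp
    qed
    show "\<exists>\<theta>\<in>local_der (\<alpha> H) (riesz I (\<alpha> H)) 0. nabla \<theta> \<zeta> = \<eta>"
      if \<eta>: "\<eta> \<in> local_der (\<alpha> H) (riesz I (\<alpha> H)) (\<nu> H)" for \<eta>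
    proof -
      obtain g where g: "\<not> linear_poly (\<alpha> H) dvd g" "to_mfrac g *s \<eta> \<in> D_mult W I \<alpha> \<nu>"
        using local_der_clear_denominator[of H \<eta> \<nu>] H \<eta> by blast
      obtain \<theta> where \<theta>: "\<theta> \<in> Der_S" "nabla \<theta> \<zeta> = to_mfrac g *s \<eta>"
        using g(2) by (rule nabla_surj)
      have "\<forall>i. \<theta> $ i \<in> R"
      proof
        fix i
        obtain p where "\<theta> $ i = to_mfrac p"
          using \<theta>(1) by (auto simp: Der_S_def)
        then show "\<theta> $ i \<in> R"
          by simp
      qed
      then have "inverse (to_mfrac g) *s \<theta> \<in> local_der (\<alpha> H) (riesz I (\<alpha> H)) 0"
        by (intro local_der_scale R_inverse_to_mfrac g(1)) (simp add: local_der_0_iff)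
      moreover have "g \<noteq> 0"
        using g(1) by auto
      then have "nabla (inverse (to_mfrac g) *s \<theta>) \<zeta> = \<eta>"
        by (simp add: nabla_smult \<theta>(2))
      ultimately show ?thesis
        by blast
    qed
  qed (rule nabla_eq_0D)
qed

text \<open>
  The conditions at the hyperplanes correspond by the local comparison. It remains to match the
  derivations with poles along the arrangement: \<open>bwd\<close> lifts such a derivation by clearing its
  poles, using universality, and dividing again.
\<close>

lemma nabla_D_mult:
  assumes \<mu>: "\<And>H. H \<in> arr \<Longrightarrow> - order_mult W H + 1 \<le> \<mu> H \<and> \<mu> H \<le> 1"
  shows "(\<lambda>\<theta>. nabla \<theta> \<zeta>) ` D_mult W I \<alpha> \<mu> = D_mult W I \<alpha> (\<lambda>H. \<nu> H + \<mu> H)"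
proof -
  let ?Q = "arr_poly W \<alpha>"
  have loc: "nabla \<theta> \<zeta> \<in> local_der (\<alpha> H) (riesz I (\<alpha> H)) (\<nu> H + \<mu> H) \<longleftrightarrow>
      \<theta> \<in> local_der (\<alpha> H) (riesz I (\<alpha> H)) (\<mu> H)" if H: "H \<in> arr" for H \<theta>
  proof -
    have "order_mult W H = int (card (stabilizer H))"
      by (simp add: order_mult_def stabilizer_def)
    then show ?thesis
      using \<mu>[OF H] by (intro local_universal.nabla_local_der_iff[OF local_universal[OF H]]) simp_all
  qed
  have fwd: "nabla \<theta> \<zeta> $ i \<in> localization_away ?Q" if "\<And>i. \<theta> $ i \<in> localization_away ?Q" for \<theta> i
    unfolding nabla_nth by (intro away_der_apply arr_poly_nonzero \<zeta>_away that)
  have bwd: "\<exists>\<theta>. (\<forall>i. \<theta> $ i \<in> localization_away ?Q) \<and> nabla \<theta> \<zeta> = \<eta>"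
    if \<eta>: "\<And>i. \<eta> $ i \<in> localization_away ?Q" for \<eta>
  proof -
    obtain k where k: "to_mfrac (?Q ^ k) *s \<eta> \<in> D_mult W I \<alpha> \<nu>"
      using D_mult_clear_pole[OF \<eta>] by blast
    obtain \<theta> where \<theta>: "\<theta> \<in> Der_S" "nabla \<theta> \<zeta> = to_mfrac (?Q ^ k) *s \<eta>"
      using k by (rule nabla_surj)
    have "(inverse (to_mfrac (?Q ^ k)) *s \<theta>) $ i \<in> localization_away ?Q" for i
    proof -
      obtain p where "\<theta> $ i = to_mfrac p"
        using \<theta>(1) by (auto simp: Der_S_def)
      then have "(inverse (to_mfrac (?Q ^ k)) *s \<theta>) $ i = to_mfrac p / to_mfrac (?Q ^ k)"
        by (simp add: divide_inverse mult.commute)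
      then show ?thesis
        unfolding localization_away_def by blast
    qed
    moreover have "nabla (inverse (to_mfrac (?Q ^ k)) *s \<theta>) \<zeta> = \<eta>"
      using arr_poly_nonzero by (simp add: nabla_smult \<theta>(2))
    ultimately show ?thesis
      by blast
  qed
  show ?thesis
  proof (intro equalityI subsetI)
    fix \<eta> assume "\<eta> \<in> (\<lambda>\<theta>. nabla \<theta> \<zeta>) ` D_mult W I \<alpha> \<mu>"
    then show "\<eta> \<in> D_mult W I \<alpha> (\<lambda>H. \<nu> H + \<mu> H)"
      using fwd loc by (auto simp: D_mult_iff)
  next
    fix \<eta> assume \<eta>: "\<eta> \<in> D_mult W I \<alpha> (\<lambda>H. \<nu> H + \<mu> H)"
    then obtain \<theta> where "\<forall>i. \<theta> $ i \<in> localization_away ?Q" "nabla \<theta> \<zeta> = \<eta>"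
      using bwd[of \<eta>] by (auto simp: D_mult_iff)
    then have "\<theta> \<in> D_mult W I \<alpha> \<mu>" "\<eta> = nabla \<theta> \<zeta>"
      using \<eta> loc by (auto simp: D_mult_iff)
    then show "\<eta> \<in> (\<lambda>\<theta>. nabla \<theta> \<zeta>) ` D_mult W I \<alpha> \<mu>"
      by blast
  qed
qed

end

theorem theorem4p19:
  fixes W :: "(('n::{finite,linorder}) cmat) set"
    and I :: "'n cvec \<Rightarrow> 'n cvec \<Rightarrow> complex"
    and \<alpha> :: "'n cvec set \<Rightarrow> 'n cvec"
    and \<nu> \<mu> :: "'n cvec set \<Rightarrow> int"
    and \<zeta> :: "'n der"
  assumes "irreducible_reflection_group W"
    and "well_generated W"
    and "hermitian_inner_product I"
    and "invariant_form W I"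
    and "defining_forms W I \<alpha>"
    and "der_invariant W \<zeta>"
    and "universal W I \<alpha> \<nu> \<zeta>"
    and "\<And>H. H \<in> refl_arrangement W \<Longrightarrow> - order_mult W H + 1 \<le> \<mu> H \<and> \<mu> H \<le> 1"
  shows "submodule_iso (\<lambda>\<theta>. nabla \<theta> \<zeta>) (D_mult W I \<alpha> \<mu>) (D_mult W I \<alpha> (\<lambda>H. \<nu> H + \<mu> H))
    \<and> (free_submodule (D_mult W I \<alpha> \<mu>) \<longleftrightarrow> free_submodule (D_mult W I \<alpha> (\<lambda>H. \<nu> H + \<mu> H)))"
proof -
  interpret universal_derivation W I \<alpha> \<nu> \<zeta>
    using assms
    by (intro universal_derivation.intro reflection_data.intro universal_derivation_axioms.intro)
      (simp_all add: irreducible_reflection_group_def)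
  note image = nabla_D_mult[OF assms(8)]
  have "bij_betw (\<lambda>\<theta>. nabla \<theta> \<zeta>) (D_mult W I \<alpha> \<mu>) (D_mult W I \<alpha> (\<lambda>H. \<nu> H + \<mu> H))"
    unfolding bij_betw_def using inj_nabla image by (auto intro: inj_on_subset)
  then have "submodule_iso (\<lambda>\<theta>. nabla \<theta> \<zeta>) (D_mult W I \<alpha> \<mu>) (D_mult W I \<alpha> (\<lambda>H. \<nu> H + \<mu> H))"
    by (simp add: submodule_iso_def subspace_D_mult nabla_add nabla_smult der_scale_smult)
  then show ?thesis
    using free_submodule_image_iff[OF module_hom_nabla inj_nabla, of "D_mult W I \<alpha> \<mu>"]
    by (simp add: image)
qed

end
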